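(* The products of class maps $\mathsf{s}\mathsf{D}_0$, $\mathsf{E}_\Phi\mathsf{D}_0$ and $\mathsf{E}_\Phi\mathsf{Q}$ are closure operations.
   Context: Algebras are (not necessarily associative) algebras over a field $K$. $H\le A$ means $H$ is a subalgebra of $A$; $N\unlhd A$ means $N$ is a (two-sided) ideal of $A$. A class of algebras is a collection of algebras closed under isomorphism. A class map sends classes of algebras to classes of algebras. A closure operation is a class map $\mathsf{C}$ such that (C1) $\mathsf{C}\emptyset=\emptyset$; (C2) $\mathfrak{X}\subseteq\mathsf{C}\mathfrak{X}$ for every class $\mathfrak{X}$, and $\mathsf{C}\mathfrak{X}\subseteq\mathsf{C}\mathfrak{Y}$ whenever $\mathfrak{X}\subseteq\mathfrak{Y}$; (C3) $\mathsf{C}(\mathsf{C}\mathfrak{X})=\mathsf{C}\mathfrak{X}$ for every class $\mathfrak{X}$. The product is composition: $(\mathsf{C}_1\mathsf{C}_2)\mathfrak{X}=\mathsf{C}_1(\mathsf{C}_2\mathfrak{X})$. The Frattini subalgebra $F(A)$ is the intersection of the maximal subalgebras of $A$ (and $F(A)=A$ if $A$ has no maximal subalgebras); the Frattini ideal $\Phi(A)$ is the largest ideal of $A$ contained in $F(A)$. For a class $\mathfrak{X}$: - $\mathsf{s}\mathfrak{X}$ is the class of all algebras $A$ with $A\le H$ for some $H\in\mathfrak{X}$; - $\mathsf{D}_0\mathfrak{X}$ is the class of all algebras $A=\bigoplus_{j=1}^r I_j$ ($r\ge1$) with each $I_j\in\mathfrak{X}$; - $\mathsf{Q}\mathfrak{X}$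 is the class of all algebras $A$ for which there are $H\in\mathfrak{X}$ and an epimorphism $H\to A$; - $\mathsf{E}_\Phi\mathfrak{X}$ is the class of all algebras $A$ having an ideal $N\unlhd A$ with $N\le\Phi(A)$ and $A/N\in\mathfrak{X}$.
   Formalization: For E_Φ D_0 the claim is proved only for classes of finite-dimensional algebras, since it fails in general (L = union of the F_{p^{2^n}} over F_p, class of zero algebras, algebra L⊕L); s D_0 and E_Φ Q are treated both for all algebras and for finite-dimensional ones. *)

theory Defs
  imports "HOL-Algebra.Module" "HOL-Algebra.QuotRing"
begin

section \<open>Not necessarily associative algebras over a field\<close>

text \<open>
  The records are those of \<^theory>\<open>HOL-Algebra.Module\<close>. Associativity, commutativity and a unit
  are not required; as for modules, the field \<^const>\<open>one\<close> of the record carries no meaning and is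
  ignored by homomorphisms.
\<close>

locale nonassoc_algebra = field K + module K A for K (structure) and A :: "(_, _) module" (structure) +
  assumes mult_closed:
      "\<lbrakk>x \<in> carrier A; y \<in> carrier A\<rbrakk> \<Longrightarrow> x \<otimes>\<^bsub>A\<^esub> y \<in> carrier A"
    and mult_l_distr:
      "\<lbrakk>x \<in> carrier A; y \<in> carrier A; z \<in> carrier A\<rbrakk> \<Longrightarrow>
        (x \<oplus>\<^bsub>A\<^esub> y) \<otimes>\<^bsub>A\<^esub> z = x \<otimes>\<^bsub>A\<^esub> z \<oplus>\<^bsub>A\<^esub> y \<otimes>\<^bsub>A\<^esub> z"
    and mult_r_distr:
      "\<lbrakk>x \<in> carrier A; y \<in> carrier A; z \<in> carrier A\<rbrakk> \<Longrightarrow>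
        z \<otimes>\<^bsub>A\<^esub> (x \<oplus>\<^bsub>A\<^esub> y) = z \<otimes>\<^bsub>A\<^esub> x \<oplus>\<^bsub>A\<^esub> z \<otimes>\<^bsub>A\<^esub> y"
    and smult_mult_l:
      "\<lbrakk>a \<in> carrier K; x \<in> carrier A; y \<in> carrier A\<rbrakk> \<Longrightarrow>
        (a \<odot>\<^bsub>A\<^esub> x) \<otimes>\<^bsub>A\<^esub> y = a \<odot>\<^bsub>A\<^esub> (x \<otimes>\<^bsub>A\<^esub> y)"
    and smult_mult_r:
      "\<lbrakk>a \<in> carrier K; x \<in> carrier A; y \<in> carrier A\<rbrakk> \<Longrightarrow>
        x \<otimes>\<^bsub>A\<^esub> (a \<odot>\<^bsub>A\<^esub> y) = a \<odot>\<^bsub>A\<^esub> (x \<otimes>\<^bsub>A\<^esub> y)"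

definition finite_dimensional :: "('k, 'm) ring_scheme \<Rightarrow> ('k, 'a) module \<Rightarrow> bool" where
  "finite_dimensional K A \<longleftrightarrow>
    (\<exists>B. finite B \<and> B \<subseteq> carrier A \<and>
      (\<forall>x \<in> carrier A. \<exists>c \<in> B \<rightarrow> carrier K. x = (\<Oplus>\<^bsub>A\<^esub>b\<in>B. c b \<odot>\<^bsub>A\<^esub> b)))"

definition alg_hom ::
    "('k, 'm) ring_scheme \<Rightarrow> ('k, 'a) module \<Rightarrow> ('k, 'b) module \<Rightarrow> ('a \<Rightarrow> 'b) set" where
  "alg_hom K A B =
    {f \<in> hom A B \<inter> hom (add_monoid A) (add_monoid B).
      \<forall>a \<in> carrier K. \<forall>x \<in> carrier A. f (a \<odot>\<^bsub>A\<^esub> x) = a \<odot>\<^bsub>B\<^esub> f x}"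

definition alg_iso :: "('k, 'm) ring_scheme \<Rightarrow> ('k, 'a) module \<Rightarrow> ('k, 'b) module \<Rightarrow> bool" where
  "alg_iso K A B \<longleftrightarrow> (\<exists>f \<in> alg_hom K A B. bij_betw f (carrier A) (carrier B))"

text \<open>The algebra structure on a subalgebra or ideal \<open>H\<close> of \<open>A\<close> is \<open>A\<lparr>carrier := H\<rparr>\<close>.\<close>

definition subalg :: "('k, 'm) ring_scheme \<Rightarrow> 'a set \<Rightarrow> ('k, 'a) module \<Rightarrow> bool" where
  "subalg K H A \<longleftrightarrow> submodule H K A \<and> (\<forall>x\<in>H. \<forall>y\<in>H. x \<otimes>\<^bsub>A\<^esub> y \<in> H)"

definition alg_ideal :: "('k, 'm) ring_scheme \<Rightarrow> 'a set \<Rightarrow> ('k, 'a) module \<Rightarrow> bool" where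
  "alg_ideal K N A \<longleftrightarrow>
    submodule N K A \<and> (\<forall>x\<in>N. \<forall>a\<in>carrier A. a \<otimes>\<^bsub>A\<^esub> x \<in> N \<and> x \<otimes>\<^bsub>A\<^esub> a \<in> N)"

definition quot_alg :: "('k, 'a) module \<Rightarrow> 'a set \<Rightarrow> ('k, 'a set) module" where
  "quot_alg A N =
    \<lparr>carrier = a_rcosets\<^bsub>A\<^esub> N, mult = rcoset_mult A N, one = N +>\<^bsub>A\<^esub> \<one>\<^bsub>A\<^esub>,
     zero = N, add = set_add A, smult = (\<lambda>a X. \<Union>x\<in>X. N +>\<^bsub>A\<^esub> (a \<odot>\<^bsub>A\<^esub> x))\<rparr>"

definition maximal_subalg :: "('k, 'm) ring_scheme \<Rightarrow> 'a set \<Rightarrow> ('k, 'a) module \<Rightarrow> bool" where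
  "maximal_subalg K M A \<longleftrightarrow>
    subalg K M A \<and> M \<noteq> carrier A \<and>
    (\<forall>H. subalg K H A \<and> M \<subseteq> H \<longrightarrow> H = M \<or> H = carrier A)"

definition frattini_subalg :: "('k, 'm) ring_scheme \<Rightarrow> ('k, 'a) module \<Rightarrow> 'a set" where
  "frattini_subalg K A =
    (if \<exists>M. maximal_subalg K M A then \<Inter>{M. maximal_subalg K M A} else carrier A)"

definition frattini_ideal :: "('k, 'm) ring_scheme \<Rightarrow> ('k, 'a) module \<Rightarrow> 'a set" where
  "frattini_ideal K A = (GREATEST I. alg_ideal K I A \<and> I \<subseteq> frattini_subalg K A)"

lemma (in nonassoc_algebra) submodule_frattini: "submodule (frattini_subalg K A) K A"
proof (rule submoduleI)
  have sub: "submodule M K A" if "maximal_subalg K M A" for M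
    using that by (simp add: maximal_subalg_def subalg_def)
  show "frattini_subalg K A \<subseteq> carrier A"
    using submoduleE(1)[OF sub] unfolding frattini_subalg_def by (auto split: if_splits)
  show "\<zero>\<^bsub>A\<^esub> \<in> frattini_subalg K A"
    using subgroup.one_closed[OF submodule.axioms(1)[OF sub]]
    unfolding frattini_subalg_def by auto
  show "\<ominus>\<^bsub>A\<^esub> x \<in> frattini_subalg K A" if "x \<in> frattini_subalg K A" for x
    using that submoduleE(3)[OF sub] unfolding frattini_subalg_def by (auto split: if_splits)
  show "x \<oplus>\<^bsub>A\<^esub> y \<in> frattini_subalg K A"
    if "x \<in> frattini_subalg K A" "y \<in> frattini_subalg K A" for x y
    using that submoduleE(5)[OF sub] unfolding frattini_subalg_def by (auto split: if_splits)
  show "a \<odot>\<^bsub>A\<^esub> x \<in> frattini_subalg K A"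
    if "a \<in> carrier K" "x \<in> frattini_subalg K A" for a x
    using that submoduleE(4)[OF sub] unfolding frattini_subalg_def by (auto split: if_splits)
qed

lemma (in nonassoc_algebra) alg_ideal_add:
  assumes "alg_ideal K I A" "alg_ideal K J A"
  shows "alg_ideal K {x \<oplus>\<^bsub>A\<^esub> y | x y. x \<in> I \<and> y \<in> J} A"
proof -
  have I: "submodule I K A" and J: "submodule J K A"
    using assms by (auto simp: alg_ideal_def)
  note IE = submoduleE[OF I] and JE = submoduleE[OF J]
  have IC: "x \<in> I \<Longrightarrow> x \<in> carrier A" and JC: "x \<in> J \<Longrightarrow> x \<in> carrier A" for x
    using IE(1) JE(1) by auto
  have "submodule {x \<oplus>\<^bsub>A\<^esub> y | x y. x \<in> I \<and> y \<in> J} K A"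
  proof (rule submoduleI)
    show "{x \<oplus>\<^bsub>A\<^esub> y | x y. x \<in> I \<and> y \<in> J} \<subseteq> carrier A"
      using IC JC by auto
    show "\<zero>\<^bsub>A\<^esub> \<in> {x \<oplus>\<^bsub>A\<^esub> y | x y. x \<in> I \<and> y \<in> J}"
      using subgroup.one_closed[OF submodule.axioms(1)[OF I]]
        subgroup.one_closed[OF submodule.axioms(1)[OF J]] by force
  next
    fix z assume "z \<in> {x \<oplus>\<^bsub>A\<^esub> y | x y. x \<in> I \<and> y \<in> J}"
    then obtain x y where z: "z = x \<oplus>\<^bsub>A\<^esub> y" "x \<in> I" "y \<in> J" by auto
    have "\<ominus>\<^bsub>A\<^esub> z = \<ominus>\<^bsub>A\<^esub> x \<oplus>\<^bsub>A\<^esub> \<ominus>\<^bsub>A\<^esub> y"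
      using z IC JC by (simp add: M.minus_add)
    then show "\<ominus>\<^bsub>A\<^esub> z \<in> {x \<oplus>\<^bsub>A\<^esub> y | x y. x \<in> I \<and> y \<in> J}"
      using z IE(3) JE(3) by blast
  next
    fix z z' assume "z \<in> {x \<oplus>\<^bsub>A\<^esub> y | x y. x \<in> I \<and> y \<in> J}"
      and "z' \<in> {x \<oplus>\<^bsub>A\<^esub> y | x y. x \<in> I \<and> y \<in> J}"
    then obtain x y x' y' where z: "z = x \<oplus>\<^bsub>A\<^esub> y" "x \<in> I" "y \<in> J"
      "z' = x' \<oplus>\<^bsub>A\<^esub> y'" "x' \<in> I" "y' \<in> J" by auto
    have "z \<oplus>\<^bsub>A\<^esub> z' = (x \<oplus>\<^bsub>A\<^esub> x') \<oplus>\<^bsub>A\<^esub> (y \<oplus>\<^bsub>A\<^esub> y')"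
      using z IC JC by (simp add: M.a_ac)
    then show "z \<oplus>\<^bsub>A\<^esub> z' \<in> {x \<oplus>\<^bsub>A\<^esub> y | x y. x \<in> I \<and> y \<in> J}"
      using z IE(5) JE(5) by blast
  next
    fix a z assume a: "a \<in> carrier K" and "z \<in> {x \<oplus>\<^bsub>A\<^esub> y | x y. x \<in> I \<and> y \<in> J}"
    then obtain x y where z: "z = x \<oplus>\<^bsub>A\<^esub> y" "x \<in> I" "y \<in> J" by auto
    have "a \<odot>\<^bsub>A\<^esub> z = a \<odot>\<^bsub>A\<^esub> x \<oplus>\<^bsub>A\<^esub> a \<odot>\<^bsub>A\<^esub> y"
      using a z IC JC by (simp add: smult_r_distr)
    then show "a \<odot>\<^bsub>A\<^esub> z \<in> {x \<oplus>\<^bsub>A\<^esub> y | x y. x \<in> I \<and> y \<in> J}"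
      using a z IE(4) JE(4) by blast
  qed
  moreover have "c \<otimes>\<^bsub>A\<^esub> z \<in> {x \<oplus>\<^bsub>A\<^esub> y | x y. x \<in> I \<and> y \<in> J} \<and>
      z \<otimes>\<^bsub>A\<^esub> c \<in> {x \<oplus>\<^bsub>A\<^esub> y | x y. x \<in> I \<and> y \<in> J}"
    if c: "c \<in> carrier A" and "z \<in> {x \<oplus>\<^bsub>A\<^esub> y | x y. x \<in> I \<and> y \<in> J}" for c z
  proof -
    from that obtain x y where z: "z = x \<oplus>\<^bsub>A\<^esub> y" "x \<in> I" "y \<in> J" by auto
    have "c \<otimes>\<^bsub>A\<^esub> z = c \<otimes>\<^bsub>A\<^esub> x \<oplus>\<^bsub>A\<^esub> c \<otimes>\<^bsub>A\<^esub> y"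
      "z \<otimes>\<^bsub>A\<^esub> c = x \<otimes>\<^bsub>A\<^esub> c \<oplus>\<^bsub>A\<^esub> y \<otimes>\<^bsub>A\<^esub> c"
      using c z IC JC by (simp_all add: mult_l_distr mult_r_distr)
    moreover have "c \<otimes>\<^bsub>A\<^esub> x \<in> I" "x \<otimes>\<^bsub>A\<^esub> c \<in> I" "c \<otimes>\<^bsub>A\<^esub> y \<in> J" "y \<otimes>\<^bsub>A\<^esub> c \<in> J"
      using assms c z by (auto simp: alg_ideal_def)
    ultimately show ?thesis by blast
  qed
  ultimately show ?thesis unfolding alg_ideal_def[of K "{x \<oplus>\<^bsub>A\<^esub> y | x y. x \<in> I \<and> y \<in> J}"]
    by (intro conjI ballI) simp_all
qed

text \<open>The largest ideal in the definition of \<^const>\<open>frattini_ideal\<close> exists.\<close>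

lemma (in nonassoc_algebra) frattini_ideal_greatest:
  shows "alg_ideal K (frattini_ideal K A) A"
    and "frattini_ideal K A \<subseteq> frattini_subalg K A"
    and "alg_ideal K J A \<Longrightarrow> J \<subseteq> frattini_subalg K A \<Longrightarrow> J \<subseteq> frattini_ideal K A"
proof -
  let ?P = "\<lambda>I. alg_ideal K I A \<and> I \<subseteq> frattini_subalg K A"
  let ?U = "\<Union>{I. ?P I}"
  note F = submoduleE[OF submodule_frattini]
  have sub: "submodule I K A" if "?P I" for I
    using that by (simp add: alg_ideal_def)
  have mul: "a \<otimes>\<^bsub>A\<^esub> x \<in> I" "x \<otimes>\<^bsub>A\<^esub> a \<in> I"
    if "?P I" "x \<in> I" "a \<in> carrier A" for I x a
    using that by (auto simp: alg_ideal_def)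
  have zero_in: "\<zero>\<^bsub>A\<^esub> \<in> I" if "submodule I K A" for I
    using subgroup.one_closed[OF submodule.axioms(1)[OF that]] by simp
  have mult_zero: "a \<otimes>\<^bsub>A\<^esub> \<zero>\<^bsub>A\<^esub> = \<zero>\<^bsub>A\<^esub>" "\<zero>\<^bsub>A\<^esub> \<otimes>\<^bsub>A\<^esub> a = \<zero>\<^bsub>A\<^esub>"
    if a: "a \<in> carrier A" for a
    using smult_mult_r[of "\<zero>\<^bsub>K\<^esub>" a "\<zero>\<^bsub>A\<^esub>"] smult_mult_l[of "\<zero>\<^bsub>K\<^esub>" "\<zero>\<^bsub>A\<^esub>" a] a
    by (simp_all add: mult_closed)
  have "submodule {\<zero>\<^bsub>A\<^esub>} K A"
    by (rule submoduleI) auto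
  then have P0: "?P {\<zero>\<^bsub>A\<^esub>}"
    using zero_in[OF submodule_frattini] by (auto simp: alg_ideal_def mult_zero)
  have add: "x \<oplus>\<^bsub>A\<^esub> y \<in> ?U" if "x \<in> ?U" "y \<in> ?U" for x y
  proof -
    from that obtain I J where IJ: "?P I" "?P J" "x \<in> I" "y \<in> J" by blast
    let ?S = "{x \<oplus>\<^bsub>A\<^esub> y | x y. x \<in> I \<and> y \<in> J}"
    have "alg_ideal K ?S A" using IJ by (intro alg_ideal_add) auto
    moreover have "?S \<subseteq> frattini_subalg K A" using IJ F(5) by blast
    moreover have "x \<oplus>\<^bsub>A\<^esub> y \<in> ?S" using IJ by blast
    ultimately show ?thesis by blast
  qed
  have "submodule ?U K A"
  proof (rule submoduleI)
    show "?U \<subseteq> carrier A" using F(1) by blast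
    show "\<zero>\<^bsub>A\<^esub> \<in> ?U" using P0 by blast
    show "\<ominus>\<^bsub>A\<^esub> x \<in> ?U" if "x \<in> ?U" for x
      using that submoduleE(3)[OF sub] by blast
    show "a \<odot>\<^bsub>A\<^esub> x \<in> ?U" if "a \<in> carrier K" "x \<in> ?U" for a x
      using that submoduleE(4)[OF sub] by blast
  qed (rule add)
  moreover have "a \<otimes>\<^bsub>A\<^esub> x \<in> ?U \<and> x \<otimes>\<^bsub>A\<^esub> a \<in> ?U" if "x \<in> ?U" "a \<in> carrier A" for x a
  proof -
    from that obtain I where I: "?P I" "x \<in> I" by blast
    from mul[OF I that(2)] I(1) show ?thesis by blast
  qed
  ultimately have "alg_ideal K ?U A"
    unfolding alg_ideal_def[of K ?U] by (intro conjI ballI) simp_all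
  then have PU: "?P ?U" by blast
  have eq: "frattini_ideal K A = ?U"
    unfolding frattini_ideal_def by (rule Greatest_equality[where P = ?P]) (use PU in blast)+
  show "alg_ideal K (frattini_ideal K A) A" "frattini_ideal K A \<subseteq> frattini_subalg K A"
    using PU unfolding eq by auto
  show "J \<subseteq> frattini_ideal K A" if "alg_ideal K J A" "J \<subseteq> frattini_subalg K A"
    using that unfolding eq by blast
qed

section \<open>Classes of algebras and closure operations\<close>

text \<open>
  All members of a class have their carriers in one type \<open>'a\<close>, which plays the role of a universe
  of sets. If \<open>'a\<close> is infinite, this universe contains, up to isomorphism, all subalgebras,
  quotients and finite direct sums of its algebras. The parameter \<open>U\<close> below is the collection
  of algebras under consideration.
\<close>

definition all_algebras :: "('k, 'm) ring_scheme \<Rightarrow> ('k, 'a) module set" where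
  "all_algebras K = {A. nonassoc_algebra K A}"

text \<open>
  For algebras of arbitrary dimension the composition of \<open>op_E_Phi\<close> and \<open>op_D0\<close> defined below is
  not a closure operation in general. Let \<open>K\<close> be a finite field and let \<open>L\<close> be the union of its
  extensions of degree \<open>2 ^ n\<close>. The nonzero proper subalgebras of \<open>L\<close> are these extensions, so \<open>L\<close>
  has no maximal subalgebra and \<open>L\<close> is its own Frattini ideal. But \<open>L\<close> is simple, so the
  diagonal is a maximal subalgebra of \<open>L \<oplus> L\<close>, which is therefore not its own Frattini ideal.
  For the class \<open>X\<close> of zero algebras, \<open>L \<oplus> L\<close> is thus obtained by applying the composition twice,
  but not by applying it once. Hence the need for \<open>fd_algebras\<close>.
\<close>

definition fd_algebras :: "('k, 'm) ring_scheme \<Rightarrow> ('k, 'a) module set" where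
  "fd_algebras K = {A. nonassoc_algebra K A \<and> finite_dimensional K A}"

definition alg_class ::
    "('k, 'm) ring_scheme \<Rightarrow> ('k, 'a) module set \<Rightarrow> ('k, 'a) module set \<Rightarrow> bool" where
  "alg_class K U X \<longleftrightarrow> X \<subseteq> U \<and> (\<forall>A\<in>X. \<forall>B\<in>U. alg_iso K A B \<longrightarrow> B \<in> X)"

definition closure_operation ::
    "('k, 'm) ring_scheme \<Rightarrow> ('k, 'a) module set \<Rightarrow>
      (('k, 'a) module set \<Rightarrow> ('k, 'a) module set) \<Rightarrow> bool" where
  "closure_operation K U C \<longleftrightarrow>
    (\<forall>X. alg_class K U X \<longrightarrow> alg_class K U (C X)) \<and>
    C {} = {} \<and>
    (\<forall>X. alg_class K U X \<longrightarrow> X \<subseteq> C X) \<and>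
    (\<forall>X Y. alg_class K U X \<and> alg_class K U Y \<and> X \<subseteq> Y \<longrightarrow> C X \<subseteq> C Y) \<and>
    (\<forall>X. alg_class K U X \<longrightarrow> C (C X) = C X)"

text \<open>
  In \<open>op_s\<close> the algebra \<open>A\<close> is only required to be isomorphic to a subalgebra of \<open>H\<close>: for a
  subset of \<open>'a\<close> there may be no room left in \<open>'a\<close> for an algebra containing it, so that the
  version without the isomorphism would not be closed under isomorphism.
\<close>

definition op_s ::
    "('k, 'm) ring_scheme \<Rightarrow> ('k, 'a) module set \<Rightarrow>
      ('k, 'a) module set \<Rightarrow> ('k, 'a) module set" where
  "op_s K U X =
    {A \<in> U. \<exists>H\<in>X. \<exists>B. subalg K B H \<and> alg_iso K A (H\<lparr>carrier := B\<rparr>)}"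

text \<open>\<open>A\<close> is the direct sum of the ideals \<open>I 1, \<dots>, I r\<close>.\<close>

definition is_direct_sum ::
    "('k, 'm) ring_scheme \<Rightarrow> ('k, 'a) module \<Rightarrow> nat \<Rightarrow> (nat \<Rightarrow> 'a set) \<Rightarrow> bool" where
  "is_direct_sum K A r I \<longleftrightarrow>
    (\<forall>j\<in>{1..r}. alg_ideal K (I j) A) \<and>
    (\<forall>x \<in> carrier A. \<exists>!f. f \<in> (\<Pi>\<^sub>E j\<in>{1..r}. I j) \<and> x = (\<Oplus>\<^bsub>A\<^esub>j\<in>{1..r}. f j))"

definition op_D0 ::
    "('k, 'm) ring_scheme \<Rightarrow> ('k, 'a) module set \<Rightarrow>
      ('k, 'a) module set \<Rightarrow> ('k, 'a) module set" where
  "op_D0 K U X =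
    {A \<in> U. \<exists>r\<ge>1. \<exists>I. is_direct_sum K A r I \<and> (\<forall>j\<in>{1..r}. A\<lparr>carrier := I j\<rparr> \<in> X)}"

definition op_Q ::
    "('k, 'm) ring_scheme \<Rightarrow> ('k, 'a) module set \<Rightarrow>
      ('k, 'a) module set \<Rightarrow> ('k, 'a) module set" where
  "op_Q K U X = {A \<in> U. \<exists>H\<in>X. \<exists>f \<in> alg_hom K H A. f ` carrier H = carrier A}"

text \<open>
  The carrier of \<open>quot_alg A N\<close> is a set of cosets, so the condition \<open>A/N \<in> X\<close> reads:
  \<open>A/N\<close> is isomorphic to a member of \<open>X\<close>.
\<close>

definition op_E_Phi ::
    "('k, 'm) ring_scheme \<Rightarrow> ('k, 'a) module set \<Rightarrow>
      ('k, 'a) module set \<Rightarrow> ('k, 'a) module set" where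
  "op_E_Phi K U X =
    {A \<in> U. \<exists>N. alg_ideal K N A \<and> N \<subseteq> frattini_ideal K A \<and>
      (\<exists>B\<in>X. alg_iso K (quot_alg A N) B)}"

end

theory Submission
  imports Defs
begin

text \<open>
  The only axiom that takes work is idempotence of the compositions. There the inner operation
  of the second application has to be moved past the outer operation of the first one, and this
  becomes easy once all operations are described by morphisms instead of by subsets.

  For \<open>op_s \<circ> op_D0\<close>: an algebra embeds in a direct sum of members of \<open>X\<close> iff it has a finite
  nonempty family of morphisms into members of \<open>X\<close> that vanish simultaneously only at zero.
  Composing such families gives such a family, which is idempotence
  (\<open>closure_operation_sD0\<close>).

  For the compositions with \<open>op_E_Phi\<close>: \<open>A\<close> lies in \<open>op_E_Phi X\<close> iff there is an epimorphism from \<open>A\<close>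
  onto a member of \<open>X\<close> whose kernel lies in the Frattini subalgebra of \<open>A\<close>. Such Frattini
  epimorphisms compose (\<open>frattini_kernel_comp\<close>), because maximal subalgebras correspond under an
  epimorphism to the maximal subalgebras containing its kernel. It remains to see, for \<open>C\<close> equal to
  \<open>op_Q\<close> or \<open>op_D0\<close>, that a member of \<open>C (op_E_Phi (C X))\<close> already lies in \<open>op_E_Phi (C X)\<close>.

  For \<open>op_Q\<close>, let \<open>g: B \<rightarrow> A\<close> be an epimorphism and \<open>f: B \<rightarrow> B'\<close> a Frattini epimorphism. In the pushout
  of the two, \<open>A\<close> is divided by \<open>g (ker f)\<close>, and this lies in the Frattini subalgebra of \<open>A\<close>
  because epimorphisms map Frattini subalgebras into Frattini subalgebras (\<open>pushout_exists\<close>).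

  For \<open>op_D0\<close>, let \<open>A\<close> be the direct sum of algebras \<open>H j\<close> with Frattini epimorphisms \<open>H j \<rightarrow> D j\<close>. The
  kernel of the induced map from \<open>A\<close> to the direct sum of the \<open>D j\<close> is the sum of the individual kernels, and
  each of these lies in every maximal subalgebra \<open>M\<close> of \<open>A\<close> by the modular law
  (\<open>component_in_frattini\<close>). This step extends a proper subalgebra of \<open>H j\<close> to a maximal one, which
  is where finite dimension enters.
\<close>

section \<open>Homomorphisms and quotients\<close>

lemma alg_homI:
  assumes "\<And>x. x \<in> carrier A \<Longrightarrow> f x \<in> carrier B"
    and "\<And>x y. \<lbrakk>x \<in> carrier A; y \<in> carrier A\<rbrakk> \<Longrightarrow> f (x \<oplus>\<^bsub>A\<^esub> y) = f x \<oplus>\<^bsub>B\<^esub> f y"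
    and "\<And>x y. \<lbrakk>x \<in> carrier A; y \<in> carrier A\<rbrakk> \<Longrightarrow> f (x \<otimes>\<^bsub>A\<^esub> y) = f x \<otimes>\<^bsub>B\<^esub> f y"
    and "\<And>a x. \<lbrakk>a \<in> carrier K; x \<in> carrier A\<rbrakk> \<Longrightarrow> f (a \<odot>\<^bsub>A\<^esub> x) = a \<odot>\<^bsub>B\<^esub> f x"
  shows "f \<in> alg_hom K A B"
  using assms by (auto simp: alg_hom_def hom_def)

lemma alg_homD:
  assumes "f \<in> alg_hom K A B"
  shows "x \<in> carrier A \<Longrightarrow> f x \<in> carrier B"
    and "\<lbrakk>x \<in> carrier A; y \<in> carrier A\<rbrakk> \<Longrightarrow> f (x \<oplus>\<^bsub>A\<^esub> y) = f x \<oplus>\<^bsub>B\<^esub> f y"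
    and "\<lbrakk>x \<in> carrier A; y \<in> carrier A\<rbrakk> \<Longrightarrow> f (x \<otimes>\<^bsub>A\<^esub> y) = f x \<otimes>\<^bsub>B\<^esub> f y"
    and "\<lbrakk>a \<in> carrier K; x \<in> carrier A\<rbrakk> \<Longrightarrow> f (a \<odot>\<^bsub>A\<^esub> x) = a \<odot>\<^bsub>B\<^esub> f x"
  using assms by (auto simp: alg_hom_def hom_def)

context nonassoc_algebra
begin

lemma mult_zero_left [simp]: "x \<in> carrier A \<Longrightarrow> \<zero>\<^bsub>A\<^esub> \<otimes>\<^bsub>A\<^esub> x = \<zero>\<^bsub>A\<^esub>"
  using smult_mult_l[of "\<zero>\<^bsub>K\<^esub>" "\<zero>\<^bsub>A\<^esub>" x] by (simp add: mult_closed)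

lemma mult_zero_right [simp]: "x \<in> carrier A \<Longrightarrow> x \<otimes>\<^bsub>A\<^esub> \<zero>\<^bsub>A\<^esub> = \<zero>\<^bsub>A\<^esub>"
  using smult_mult_r[of "\<zero>\<^bsub>K\<^esub>" x "\<zero>\<^bsub>A\<^esub>"] by (simp add: mult_closed)

lemma minus_eq_zero_iff [simp]:
  assumes "x \<in> carrier A" "y \<in> carrier A"
  shows "x \<ominus>\<^bsub>A\<^esub> y = \<zero>\<^bsub>A\<^esub> \<longleftrightarrow> x = y"
proof
  assume "x \<ominus>\<^bsub>A\<^esub> y = \<zero>\<^bsub>A\<^esub>"
  then have "\<ominus>\<^bsub>A\<^esub> (\<ominus>\<^bsub>A\<^esub> y) = x"
    using assms by (intro M.minus_equality) (auto simp: a_minus_def)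
  then show "x = y" using assms by simp
qed (use assms in \<open>simp add: a_minus_def M.r_neg\<close>)

lemma subalgI:
  assumes "H \<subseteq> carrier A" "\<zero>\<^bsub>A\<^esub> \<in> H"
    and "\<And>x y. \<lbrakk>x \<in> H; y \<in> H\<rbrakk> \<Longrightarrow> x \<oplus>\<^bsub>A\<^esub> y \<in> H"
    and smult: "\<And>a x. \<lbrakk>a \<in> carrier K; x \<in> H\<rbrakk> \<Longrightarrow> a \<odot>\<^bsub>A\<^esub> x \<in> H"
    and "\<And>x y. \<lbrakk>x \<in> H; y \<in> H\<rbrakk> \<Longrightarrow> x \<otimes>\<^bsub>A\<^esub> y \<in> H"
  shows "subalg K H A"
  unfolding subalg_def
proof (intro conjI submoduleI ballI)
  show "\<ominus>\<^bsub>A\<^esub> x \<in> H" if "x \<in> H" for x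
    using smult[of "\<ominus>\<^bsub>K\<^esub> \<one>\<^bsub>K\<^esub>" x] that assms(1) smult_l_minus[of "\<one>\<^bsub>K\<^esub>" x] by auto
qed (use assms in auto)

lemma subalgD:
  assumes "subalg K H A"
  shows "x \<in> H \<Longrightarrow> x \<in> carrier A" "\<zero>\<^bsub>A\<^esub> \<in> H" "x \<in> H \<Longrightarrow> \<ominus>\<^bsub>A\<^esub> x \<in> H"
    "\<lbrakk>x \<in> H; y \<in> H\<rbrakk> \<Longrightarrow> x \<oplus>\<^bsub>A\<^esub> y \<in> H"
    "\<lbrakk>x \<in> H; y \<in> H\<rbrakk> \<Longrightarrow> x \<ominus>\<^bsub>A\<^esub> y \<in> H"
    "\<lbrakk>a \<in> carrier K; x \<in> H\<rbrakk> \<Longrightarrow> a \<odot>\<^bsub>A\<^esub> x \<in> H"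
    "\<lbrakk>x \<in> H; y \<in> H\<rbrakk> \<Longrightarrow> x \<otimes>\<^bsub>A\<^esub> y \<in> H"
  using submoduleE[of H] subgroup.one_closed[OF submodule.axioms(1), of H K A] assms
  by (auto simp: subalg_def a_minus_def)

lemma alg_idealI:
  assumes "subalg K N A"
    and "\<And>x a. \<lbrakk>x \<in> N; a \<in> carrier A\<rbrakk> \<Longrightarrow> a \<otimes>\<^bsub>A\<^esub> x \<in> N"
    and "\<And>x a. \<lbrakk>x \<in> N; a \<in> carrier A\<rbrakk> \<Longrightarrow> x \<otimes>\<^bsub>A\<^esub> a \<in> N"
  shows "alg_ideal K N A"
  using assms by (auto simp: alg_ideal_def subalg_def)

lemma alg_idealD:
  assumes "alg_ideal K N A"
  shows "subalg K N A" "\<lbrakk>x \<in> N; a \<in> carrier A\<rbrakk> \<Longrightarrow> a \<otimes>\<^bsub>A\<^esub> x \<in> N"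
    "\<lbrakk>x \<in> N; a \<in> carrier A\<rbrakk> \<Longrightarrow> x \<otimes>\<^bsub>A\<^esub> a \<in> N"
  using assms submoduleE(1)[of N] by (auto simp: alg_ideal_def subalg_def)

lemma submodule_finsum:
  assumes "submodule S K A" "\<And>j. j \<in> J \<Longrightarrow> g j \<in> S"
  shows "finsum A g J \<in> S"
proof -
  have S: "S \<subseteq> carrier A" "\<zero>\<^bsub>A\<^esub> \<in> S" "\<And>x y. x \<in> S \<Longrightarrow> y \<in> S \<Longrightarrow> x \<oplus>\<^bsub>A\<^esub> y \<in> S"
    using submoduleE[OF assms(1)] subgroup.one_closed[OF submodule.axioms(1)[OF assms(1)]]
    by auto
  show ?thesis
    using assms(2)
  proof (induction J rule: infinite_finite_induct)
    case (insert j J)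
    then have "g \<in> J \<rightarrow> carrier A" "g j \<in> carrier A" using S(1) by auto
    then show ?case using insert S(3) by simp
  qed (use S in auto)
qed

lemma subalg_carrier: "subalg K (carrier A) A"
  by (rule subalgI) (auto simp: mult_closed)

end

text \<open>
  The identities that define an algebra pass along any surjection compatible with the operations.
  This is how quotients, copies of an algebra in another type, and direct summands are recognised
  as algebras.
\<close>

lemma algebra_surjective_image:
  assumes "nonassoc_algebra K A" and f: "f \<in> alg_hom K A B"
    and zero: "f \<zero>\<^bsub>A\<^esub> = \<zero>\<^bsub>B\<^esub>" and surj: "f ` carrier A = carrier B"
  shows "nonassoc_algebra K B"
proof -
  interpret A: nonassoc_algebra K A by fact
  note [simp] = alg_homD(2-4)[OF f, symmetric]
  have ex: "\<exists>x. x \<in> carrier A \<and> u = f x" if "u \<in> carrier B" for u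
    using that surj by blast
  have clos: "x \<in> carrier A \<Longrightarrow> f x \<in> carrier B" for x using alg_homD(1)[OF f] .
  note P = A.mult_closed[THEN clos] A.M.a_closed[THEN clos] A.smult_closed[THEN clos]
  have "abelian_group B"
  proof (rule abelian_groupI)
    fix u assume "u \<in> carrier B"
    then obtain x where x: "x \<in> carrier A" "u = f x" using ex by blast
    show "\<zero>\<^bsub>B\<^esub> \<oplus>\<^bsub>B\<^esub> u = u" using x by (simp add: zero[symmetric])
    have "f (\<ominus>\<^bsub>A\<^esub> x) \<oplus>\<^bsub>B\<^esub> u = \<zero>\<^bsub>B\<^esub>"
      using x by (simp add: A.M.l_neg zero[symmetric])
    then show "\<exists>v\<in>carrier B. v \<oplus>\<^bsub>B\<^esub> u = \<zero>\<^bsub>B\<^esub>" using x clos by blast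
  next
    show "\<zero>\<^bsub>B\<^esub> \<in> carrier B" using clos[of "\<zero>\<^bsub>A\<^esub>"] zero by simp
  qed (auto dest!: ex simp: P A.M.a_ac)
  then have "module K B"
    by (intro moduleI module.axioms(1)[OF A.module_axioms])
      (auto dest!: ex simp: P A.smult_l_distr A.smult_r_distr A.smult_assoc1)
  moreover have "nonassoc_algebra_axioms K B"
    by (unfold_locales)
      (auto dest!: ex simp: P A.mult_closed A.mult_l_distr A.mult_r_distr A.smult_mult_l
        A.smult_mult_r)
  ultimately show ?thesis
    using A.field_axioms by (simp add: nonassoc_algebra_def)
qed

locale alg_morphism = A: nonassoc_algebra K A + B: nonassoc_algebra K B
  for K :: "('k, 'm) ring_scheme" and A :: "('k, 'a) module" and B :: "('k, 'b) module" +
  fixes f :: "'a \<Rightarrow> 'b"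
  assumes hom: "f \<in> alg_hom K A B"
begin

lemmas map_closed [simp] = alg_homD(1)[OF hom]
lemmas map_add [simp] = alg_homD(2)[OF hom]
lemmas map_mult [simp] = alg_homD(3)[OF hom]
lemmas map_smult [simp] = alg_homD(4)[OF hom]

lemma map_zero [simp]: "f \<zero>\<^bsub>A\<^esub> = \<zero>\<^bsub>B\<^esub>"
  using map_smult[of "\<zero>\<^bsub>K\<^esub>" "\<zero>\<^bsub>A\<^esub>"] by simp

lemma map_uminus [simp]: "x \<in> carrier A \<Longrightarrow> f (\<ominus>\<^bsub>A\<^esub> x) = \<ominus>\<^bsub>B\<^esub> f x"
  using map_smult[of "\<ominus>\<^bsub>K\<^esub> \<one>\<^bsub>K\<^esub>" x] by (simp add: A.smult_l_minus B.smult_l_minus)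

lemma map_minus [simp]: "\<lbrakk>x \<in> carrier A; y \<in> carrier A\<rbrakk> \<Longrightarrow> f (x \<ominus>\<^bsub>A\<^esub> y) = f x \<ominus>\<^bsub>B\<^esub> f y"
  by (simp add: a_minus_def)

lemma map_finsum:
  "g \<in> J \<rightarrow> carrier A \<Longrightarrow> f (finsum A g J) = finsum B (\<lambda>j. f (g j)) J"
  by (induction J rule: infinite_finite_induct) (auto simp: Pi_def)

lemma map_eq_iff:
  assumes "x \<in> carrier A" "y \<in> carrier A"
  shows "f x = f y \<longleftrightarrow> x \<ominus>\<^bsub>A\<^esub> y \<in> a_kernel A B f"
  using assms by (simp add: a_kernel_def' A.M.minus_closed)

lemma inj_on_iff: "inj_on f (carrier A) \<longleftrightarrow> (\<forall>x\<in>carrier A. f x = \<zero>\<^bsub>B\<^esub> \<longrightarrow> x = \<zero>\<^bsub>A\<^esub>)"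
proof
  assume "inj_on f (carrier A)"
  then show "\<forall>x\<in>carrier A. f x = \<zero>\<^bsub>B\<^esub> \<longrightarrow> x = \<zero>\<^bsub>A\<^esub>"
    using inj_onD[of f "carrier A" _ "\<zero>\<^bsub>A\<^esub>"] by auto
next
  assume inj: "\<forall>x\<in>carrier A. f x = \<zero>\<^bsub>B\<^esub> \<longrightarrow> x = \<zero>\<^bsub>A\<^esub>"
  show "inj_on f (carrier A)"
  proof (rule inj_onI)
    fix x y assume "x \<in> carrier A" "y \<in> carrier A" "f x = f y"
    moreover from this have "x \<ominus>\<^bsub>A\<^esub> y = \<zero>\<^bsub>A\<^esub>" using inj by simp
    ultimately show "x = y" by simp
  qed
qed

lemma subalg_preimage:
  assumes "subalg K H B"
  shows "subalg K {x \<in> carrier A. f x \<in> H} A"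
  using B.subalgD[OF assms] by (intro A.subalgI) (auto simp: A.mult_closed)

lemma subalg_image:
  assumes "subalg K H A"
  shows "subalg K (f ` H) B"
proof -
  note H = A.subalgD[OF assms]
  show ?thesis
  proof (rule B.subalgI)
    show "\<zero>\<^bsub>B\<^esub> \<in> f ` H" using H(2) by (intro image_eqI[of _ _ "\<zero>\<^bsub>A\<^esub>"]) simp_all
  next
    fix u v assume "u \<in> f ` H" "v \<in> f ` H"
    then obtain x y where "x \<in> H" "y \<in> H" "u = f x" "v = f y" by blast
    then show "u \<oplus>\<^bsub>B\<^esub> v \<in> f ` H" "u \<otimes>\<^bsub>B\<^esub> v \<in> f ` H"
      using H by (auto simp flip: map_add map_mult)
  next
    fix a u assume "a \<in> carrier K" "u \<in> f ` H"
    then show "a \<odot>\<^bsub>B\<^esub> u \<in> f ` H" using H by (auto simp flip: map_smult)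
  qed (use H in auto)
qed

lemma submodule_preimage:
  assumes "submodule S K B"
  shows "submodule {x \<in> carrier A. f x \<in> S} K A"
  using B.submoduleE[OF assms] subgroup.one_closed[OF submodule.axioms(1)[OF assms]]
  by (intro A.submoduleI) auto

lemma submodule_image:
  assumes "submodule S K A"
  shows "submodule (f ` S) K B"
proof -
  note S = A.submoduleE[OF assms] subgroup.one_closed[OF submodule.axioms(1)[OF assms]]
  have C: "x \<in> S \<Longrightarrow> x \<in> carrier A" for x using S(1) by blast
  show ?thesis
  proof (rule B.submoduleI)
    show "\<zero>\<^bsub>B\<^esub> \<in> f ` S" using S(7) by (intro image_eqI[of _ _ "\<zero>\<^bsub>A\<^esub>"]) simp_all
  next
    fix u assume "u \<in> f ` S"
    then show "\<ominus>\<^bsub>B\<^esub> u \<in> f ` S" using S(3) C by (auto simp flip: map_uminus)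
  next
    fix u v assume "u \<in> f ` S" "v \<in> f ` S"
    then obtain x y where "x \<in> S" "y \<in> S" "u = f x" "v = f y" by blast
    then show "u \<oplus>\<^bsub>B\<^esub> v \<in> f ` S"
      using S(5) C by (auto simp flip: map_add)
  next
    fix a u assume "a \<in> carrier K" "u \<in> f ` S"
    then show "a \<odot>\<^bsub>B\<^esub> u \<in> f ` S" using S(4) C by (auto simp flip: map_smult)
  qed (use C in auto)
qed

lemma ideal_kernel: "alg_ideal K (a_kernel A B f) A"
  by (intro A.alg_idealI A.subalgI) (auto simp: a_kernel_def' A.mult_closed)

end

lemma alg_morphism_id: "nonassoc_algebra K A \<Longrightarrow> alg_morphism K A A id"
  by (simp add: alg_morphism_def alg_morphism_axioms_def alg_homI)

lemma alg_morphism_comp: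
  assumes "alg_morphism K A B f" "alg_morphism K B C g"
  shows "alg_morphism K A C (g \<circ> f)"
proof -
  interpret f: alg_morphism K A B f by fact
  interpret g: alg_morphism K B C g by fact
  show ?thesis by unfold_locales (auto intro!: alg_homI)
qed

locale alg_epi = alg_morphism +
  assumes surj: "f ` carrier A = carrier B"
begin

lemma preimage_exists: "u \<in> carrier B \<Longrightarrow> \<exists>x. x \<in> carrier A \<and> u = f x"
  using surj by blast

lemma ideal_image:
  assumes "alg_ideal K N A"
  shows "alg_ideal K (f ` N) B"
proof (rule B.alg_idealI)
  note N = A.alg_idealD[OF assms] A.subalgD(1)[OF A.alg_idealD(1)[OF assms]]
  show "subalg K (f ` N) B" using N(1) by (rule subalg_image)
  fix u b assume "u \<in> f ` N" "b \<in> carrier B"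
  then obtain x a where "x \<in> N" "u = f x" "a \<in> carrier A" "b = f a"
    using preimage_exists by blast
  then show "b \<otimes>\<^bsub>B\<^esub> u \<in> f ` N" "u \<otimes>\<^bsub>B\<^esub> b \<in> f ` N"
    using N by (auto simp flip: map_mult)
qed

lemma factor_through:
  assumes "alg_morphism K A C g" and ker: "a_kernel A B f \<subseteq> a_kernel A C g"
  obtains h where "alg_morphism K B C h" "\<And>x. x \<in> carrier A \<Longrightarrow> h (f x) = g x"
proof -
  interpret g: alg_morphism K A C g by fact
  define h where "h = (\<lambda>u. g (inv_into (carrier A) f u))"
  have h: "h (f x) = g x" if "x \<in> carrier A" for x
  proof -
    have "inv_into (carrier A) f (f x) \<in> carrier A" "f (inv_into (carrier A) f (f x)) = f x"
      using that by (auto intro: inv_into_into f_inv_into_f)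
    then show ?thesis using that ker by (auto simp: h_def map_eq_iff g.map_eq_iff)
  qed
  have "alg_morphism K B C h"
    by unfold_locales
      (auto intro!: alg_homI dest!: preimage_exists simp: h A.mult_closed
        simp flip: map_add map_mult map_smult)
  then show thesis using h that by blast
qed

end

lemma alg_epi_comp: "alg_epi K A B f \<Longrightarrow> alg_epi K B C g \<Longrightarrow> alg_epi K A C (g \<circ> f)"
  unfolding alg_epi_def alg_epi_axioms_def by (metis alg_morphism_comp image_comp)

lemma alg_epi_inverse:
  assumes "alg_epi K A B f" "inj_on f (carrier A)"
  obtains h where "alg_epi K B A h" "\<And>x. x \<in> carrier A \<Longrightarrow> h (f x) = x"
    "inj_on h (carrier B)"
proof -
  interpret alg_epi K A B f by fact
  have "a_kernel A B f \<subseteq> a_kernel A A id"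
    using assms(2) by (auto simp: a_kernel_def' inj_on_iff)
  then obtain h where h: "alg_morphism K B A h" "\<And>x. x \<in> carrier A \<Longrightarrow> h (f x) = id x"
    using factor_through[OF alg_morphism_id] A.nonassoc_algebra_axioms by metis
  have "h ` carrier B = carrier A"
    using h(2) unfolding surj[symmetric] image_image by simp
  moreover have "inj_on h (carrier B)"
    using h(2) unfolding surj[symmetric] by (auto intro!: inj_onI)
  ultimately show thesis using that h by (auto simp: alg_epi_def alg_epi_axioms_def)
qed

lemma alg_epiI:
  assumes "nonassoc_algebra K A" "f \<in> alg_hom K A B" "f \<zero>\<^bsub>A\<^esub> = \<zero>\<^bsub>B\<^esub>" "f ` carrier A = carrier B"
  shows "alg_epi K A B f"
  using assms algebra_surjective_image[OF assms]
  by (simp add: alg_epi_def alg_epi_axioms_def alg_morphism_def alg_morphism_axioms_def)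

lemma alg_iso_iff:
  assumes "nonassoc_algebra K A" "nonassoc_algebra K B"
  shows "alg_iso K A B \<longleftrightarrow> (\<exists>f. alg_epi K A B f \<and> inj_on f (carrier A))"
  using assms by (auto simp: alg_iso_def bij_betw_def alg_epi_def alg_epi_axioms_def
      alg_morphism_def alg_morphism_axioms_def)

text \<open>
  A function whose fibres form a congruence carries the algebra structure over to its range, whatever
  the type of the range. Injective functions give copies of an algebra in another type; a choice
  of representatives modulo an ideal gives quotients that remain in the given type.
\<close>

lemma algebra_on_range:
  fixes \<phi> :: "'b \<Rightarrow> 'c"
  assumes A: "nonassoc_algebra K A"
    and add: "\<And>x x' y y'. \<lbrakk>x \<in> carrier A; x' \<in> carrier A; y \<in> carrier A; y' \<in> carrier A;
      \<phi> x = \<phi> x'; \<phi> y = \<phi> y'\<rbrakk> \<Longrightarrow> \<phi> (x \<oplus>\<^bsub>A\<^esub> y) = \<phi> (x' \<oplus>\<^bsub>A\<^esub> y')"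
    and mult: "\<And>x x' y y'. \<lbrakk>x \<in> carrier A; x' \<in> carrier A; y \<in> carrier A; y' \<in> carrier A;
      \<phi> x = \<phi> x'; \<phi> y = \<phi> y'\<rbrakk> \<Longrightarrow> \<phi> (x \<otimes>\<^bsub>A\<^esub> y) = \<phi> (x' \<otimes>\<^bsub>A\<^esub> y')"
    and smult: "\<And>a x x'. \<lbrakk>a \<in> carrier K; x \<in> carrier A; x' \<in> carrier A; \<phi> x = \<phi> x'\<rbrakk>
      \<Longrightarrow> \<phi> (a \<odot>\<^bsub>A\<^esub> x) = \<phi> (a \<odot>\<^bsub>A\<^esub> x')"
  obtains B :: "('k, 'c) module" where "alg_epi K A B \<phi>"
proof -
  interpret A: nonassoc_algebra K A by fact
  define s where "s = inv_into (carrier A) \<phi>"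
  have s: "s (\<phi> x) \<in> carrier A" "\<phi> (s (\<phi> x)) = \<phi> x" if "x \<in> carrier A" for x
    using that by (auto simp: s_def intro: inv_into_into f_inv_into_f)
  define B :: "('k, 'c) module" where
    "B = \<lparr>carrier = \<phi> ` carrier A, mult = (\<lambda>u v. \<phi> (s u \<otimes>\<^bsub>A\<^esub> s v)), one = \<phi> \<zero>\<^bsub>A\<^esub>,
      zero = \<phi> \<zero>\<^bsub>A\<^esub>, add = (\<lambda>u v. \<phi> (s u \<oplus>\<^bsub>A\<^esub> s v)), smult = (\<lambda>a u. \<phi> (a \<odot>\<^bsub>A\<^esub> s u))\<rparr>"
  have "alg_epi K A B \<phi>"
  proof (rule alg_epiI)
    show "\<phi> \<in> alg_hom K A B"
      using s by (intro alg_homI) (auto simp: B_def intro!: add mult smult)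
  qed (simp_all add: A B_def)
  then show thesis by (rule that)
qed

lemma transfer_algebra:
  fixes \<phi> :: "'b \<Rightarrow> 'c"
  assumes "nonassoc_algebra K A" "inj_on \<phi> (carrier A)"
  obtains B :: "('k, 'c) module" where "alg_epi K A B \<phi>"
proof -
  have eq: "x = y" if "\<phi> x = \<phi> y" "x \<in> carrier A" "y \<in> carrier A" for x y
    using that assms(2) by (auto dest: inj_onD)
  obtain B :: "('k, 'c) module" where "alg_epi K A B \<phi>"
    by (rule algebra_on_range[OF assms(1), where \<phi> = \<phi>]) (metis eq)+
  then show thesis by (rule that)
qed

context nonassoc_algebra
begin

lemma congruent_mod_ideal:
  assumes N: "alg_ideal K N A" and C: "x \<in> carrier A" "x' \<in> carrier A" "x \<ominus>\<^bsub>A\<^esub> x' \<in> N"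
  shows "a \<in> carrier K \<Longrightarrow> a \<odot>\<^bsub>A\<^esub> x \<ominus>\<^bsub>A\<^esub> a \<odot>\<^bsub>A\<^esub> x' \<in> N"
    and "\<lbrakk>y \<in> carrier A; y' \<in> carrier A; y \<ominus>\<^bsub>A\<^esub> y' \<in> N\<rbrakk> \<Longrightarrow>
      (x \<oplus>\<^bsub>A\<^esub> y) \<ominus>\<^bsub>A\<^esub> (x' \<oplus>\<^bsub>A\<^esub> y') \<in> N"
    and "\<lbrakk>y \<in> carrier A; y' \<in> carrier A; y \<ominus>\<^bsub>A\<^esub> y' \<in> N\<rbrakk> \<Longrightarrow>
      x \<otimes>\<^bsub>A\<^esub> y \<ominus>\<^bsub>A\<^esub> x' \<otimes>\<^bsub>A\<^esub> y' \<in> N"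
proof -
  note NS = subalgD[OF alg_idealD(1)[OF N]]
  note c = C(1,2)
  show "a \<odot>\<^bsub>A\<^esub> x \<ominus>\<^bsub>A\<^esub> a \<odot>\<^bsub>A\<^esub> x' \<in> N" if a: "a \<in> carrier K"
    using NS(6)[OF a C(3)] a c by (simp add: a_minus_def smult_r_distr smult_r_minus)
  assume y: "y \<in> carrier A" "y' \<in> carrier A" "y \<ominus>\<^bsub>A\<^esub> y' \<in> N"
  have "(x \<oplus>\<^bsub>A\<^esub> y) \<ominus>\<^bsub>A\<^esub> (x' \<oplus>\<^bsub>A\<^esub> y') = (x \<ominus>\<^bsub>A\<^esub> x') \<oplus>\<^bsub>A\<^esub> (y \<ominus>\<^bsub>A\<^esub> y')"
    using c y(1,2) by (simp add: a_minus_def M.minus_add M.a_ac)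
  then show "(x \<oplus>\<^bsub>A\<^esub> y) \<ominus>\<^bsub>A\<^esub> (x' \<oplus>\<^bsub>A\<^esub> y') \<in> N" using NS(4) C y by simp
  have d: "u = (u \<ominus>\<^bsub>A\<^esub> v) \<oplus>\<^bsub>A\<^esub> v" if "u \<in> carrier A" "v \<in> carrier A" for u v
    using that by (simp add: a_minus_def M.a_assoc M.l_neg)
  have e: "(u \<oplus>\<^bsub>A\<^esub> v \<oplus>\<^bsub>A\<^esub> w) \<ominus>\<^bsub>A\<^esub> w = u \<oplus>\<^bsub>A\<^esub> v"
    if "u \<in> carrier A" "v \<in> carrier A" "w \<in> carrier A" for u v w
    using that by (simp add: a_minus_def M.a_assoc M.r_neg)
  define p where "p = x \<ominus>\<^bsub>A\<^esub> x'"
  define q where "q = y \<ominus>\<^bsub>A\<^esub> y'"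
  have pq: "p \<in> N" "q \<in> N" "p \<in> carrier A" "q \<in> carrier A"
    using C y by (simp_all add: p_def q_def M.minus_closed)
  have "x \<otimes>\<^bsub>A\<^esub> y = p \<otimes>\<^bsub>A\<^esub> y \<oplus>\<^bsub>A\<^esub> x' \<otimes>\<^bsub>A\<^esub> y"
    using d[of x x'] c y pq mult_l_distr[of p x' y] by (simp flip: p_def)
  also have "\<dots> = p \<otimes>\<^bsub>A\<^esub> y \<oplus>\<^bsub>A\<^esub> (x' \<otimes>\<^bsub>A\<^esub> q \<oplus>\<^bsub>A\<^esub> x' \<otimes>\<^bsub>A\<^esub> y')"
    using d[of y y'] c y pq mult_r_distr[of q y' x'] by (simp flip: q_def)
  finally have "x \<otimes>\<^bsub>A\<^esub> y = p \<otimes>\<^bsub>A\<^esub> y \<oplus>\<^bsub>A\<^esub> x' \<otimes>\<^bsub>A\<^esub> q \<oplus>\<^bsub>A\<^esub> x' \<otimes>\<^bsub>A\<^esub> y'"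
    using c y pq by (simp add: mult_closed M.a_assoc)
  then have "x \<otimes>\<^bsub>A\<^esub> y \<ominus>\<^bsub>A\<^esub> x' \<otimes>\<^bsub>A\<^esub> y' = p \<otimes>\<^bsub>A\<^esub> y \<oplus>\<^bsub>A\<^esub> x' \<otimes>\<^bsub>A\<^esub> q"
    using e c y pq by (simp add: mult_closed)
  then show "x \<otimes>\<^bsub>A\<^esub> y \<ominus>\<^bsub>A\<^esub> x' \<otimes>\<^bsub>A\<^esub> y' \<in> N"
    using alg_idealD[OF N] NS(4) c y pq by auto
qed

end

lemma quotient_exists:
  fixes A :: "('k, 'a) module"
  assumes "nonassoc_algebra K A" and N: "alg_ideal K N A"
  obtains B :: "('k, 'a) module" and f where "alg_epi K A B f" "a_kernel A B f = N"
proof -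
  interpret nonassoc_algebra K A by fact
  note NS = subalgD[OF alg_idealD(1)[OF N]]
  define f where "f x = (SOME y. y \<in> carrier A \<and> x \<ominus>\<^bsub>A\<^esub> y \<in> N)" for x
  have refl: "x \<ominus>\<^bsub>A\<^esub> x \<in> N" if "x \<in> carrier A" for x
    using that NS(2) by (simp add: M.r_neg a_minus_def)
  have f: "f x \<in> carrier A \<and> x \<ominus>\<^bsub>A\<^esub> f x \<in> N" if "x \<in> carrier A" for x
    unfolding f_def using refl that by (metis (mono_tags, lifting) someI)
  have sym: "y \<ominus>\<^bsub>A\<^esub> x \<in> N" if "x \<in> carrier A" "y \<in> carrier A" "x \<ominus>\<^bsub>A\<^esub> y \<in> N" for x y
  proof -
    have "y \<ominus>\<^bsub>A\<^esub> x = \<ominus>\<^bsub>A\<^esub> (x \<ominus>\<^bsub>A\<^esub> y)"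
      using that by (simp add: a_minus_def M.minus_add M.a_comm)
    then show ?thesis using NS(3) that by simp
  qed
  have trans: "x \<ominus>\<^bsub>A\<^esub> z \<in> N" if "x \<in> carrier A" "y \<in> carrier A" "z \<in> carrier A"
    "x \<ominus>\<^bsub>A\<^esub> y \<in> N" "y \<ominus>\<^bsub>A\<^esub> z \<in> N" for x y z
  proof -
    have "x \<ominus>\<^bsub>A\<^esub> z = (x \<ominus>\<^bsub>A\<^esub> y) \<oplus>\<^bsub>A\<^esub> (y \<ominus>\<^bsub>A\<^esub> z)"
      using that by (simp add: a_minus_def M.a_ac M.r_neg1 M.r_neg2)
    then show ?thesis using NS(4) that by simp
  qed
  have eq: "f x = f y \<longleftrightarrow> x \<ominus>\<^bsub>A\<^esub> y \<in> N" if xy: "x \<in> carrier A" "y \<in> carrier A" for x y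
  proof
    assume "f x = f y"
    then show "x \<ominus>\<^bsub>A\<^esub> y \<in> N" using f[OF xy(1)] f[OF xy(2)] xy sym trans by metis
  next
    assume "x \<ominus>\<^bsub>A\<^esub> y \<in> N"
    then have "(z \<in> carrier A \<and> x \<ominus>\<^bsub>A\<^esub> z \<in> N) = (z \<in> carrier A \<and> y \<ominus>\<^bsub>A\<^esub> z \<in> N)" for z
      using xy sym trans by metis
    then show "f x = f y" by (simp add: f_def)
  qed
  obtain B :: "('k, 'a) module" where B: "alg_epi K A B f"
    by (rule algebra_on_range[OF nonassoc_algebra_axioms, where \<phi> = f])
      (use congruent_mod_ideal[OF N] in \<open>simp_all add: eq mult_closed\<close>)
  interpret alg_epi K A B f by fact
  have "x \<ominus>\<^bsub>A\<^esub> \<zero>\<^bsub>A\<^esub> = x" if "x \<in> carrier A" for x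
    using that by (simp add: a_minus_def)
  then have "a_kernel A B f = N"
    using NS(1) eq[of _ "\<zero>\<^bsub>A\<^esub>"] by (auto simp: a_kernel_def')
  then show thesis using B that by blast
qed

section \<open>The Frattini subalgebra under epimorphisms\<close>

lemma (in nonassoc_algebra) frattini_subalgI:
  assumes "x \<in> carrier A" "\<And>M. maximal_subalg K M A \<Longrightarrow> x \<in> M"
  shows "x \<in> frattini_subalg K A"
  using assms by (auto simp: frattini_subalg_def)

lemma (in nonassoc_algebra) frattini_subalgD:
  assumes "x \<in> frattini_subalg K A"
  shows "x \<in> carrier A" "maximal_subalg K M A \<Longrightarrow> x \<in> M"
  using assms submoduleE(1)[OF submodule_frattini] by (auto simp: frattini_subalg_def split: if_splits)

context alg_epi
begin

lemma image_preimage: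
  assumes "H \<subseteq> carrier B"
  shows "f ` {x \<in> carrier A. f x \<in> H} = H"
proof
  show "H \<subseteq> f ` {x \<in> carrier A. f x \<in> H}"
    using assms preimage_exists by (auto simp: image_iff)
qed auto

lemma preimage_image:
  assumes H: "subalg K H A" and ker: "a_kernel A B f \<subseteq> H"
  shows "{x \<in> carrier A. f x \<in> f ` H} = H"
proof -
  note HS = A.subalgD[OF H]
  have "x \<in> H" if x: "x \<in> carrier A" and y: "y \<in> H" "f x = f y" for x y
  proof -
    have "x \<ominus>\<^bsub>A\<^esub> y \<in> H" using map_eq_iff[of x y] x y HS(1) ker by auto
    moreover have "x = (x \<ominus>\<^bsub>A\<^esub> y) \<oplus>\<^bsub>A\<^esub> y"
      using x HS(1)[OF y(1)] by (simp add: a_minus_def A.M.a_assoc A.M.l_neg)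
    ultimately show ?thesis using HS(4)[OF _ y(1)] by metis
  qed
  then show ?thesis using HS(1) by blast
qed

lemma maximal_preimage:
  assumes "maximal_subalg K M B"
  shows "maximal_subalg K {x \<in> carrier A. f x \<in> M} A" (is "maximal_subalg K ?M A")
  unfolding maximal_subalg_def
proof (intro conjI allI impI)
  have M: "subalg K M B" "M \<noteq> carrier B" "M \<subseteq> carrier B"
    and max: "\<And>H. \<lbrakk>subalg K H B; M \<subseteq> H\<rbrakk> \<Longrightarrow> H = M \<or> H = carrier B"
    using assms B.subalgD(1) by (auto simp: maximal_subalg_def)
  have fM: "f ` ?M = M" using M(3) by (rule image_preimage)
  show "subalg K ?M A" using M(1) by (rule subalg_preimage)
  show "?M \<noteq> carrier A" using M(2) fM surj by metis
  fix H assume "subalg K H A \<and> ?M \<subseteq> H"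
  then have H: "subalg K H A" "?M \<subseteq> H" by auto
  have "a_kernel A B f \<subseteq> ?M" using B.subalgD(2)[OF M(1)] by (auto simp: a_kernel_def')
  then have pre: "{x \<in> carrier A. f x \<in> f ` H} = H"
    using H by (intro preimage_image) auto
  have "M \<subseteq> f ` H" using H(2) fM by blast
  then have "f ` H = M \<or> f ` H = carrier B" using max subalg_image[OF H(1)] by blast
  then show "H = ?M \<or> H = carrier A" using pre by auto
qed

lemma maximal_image:
  assumes M: "maximal_subalg K M A" and ker: "a_kernel A B f \<subseteq> M"
  shows "maximal_subalg K (f ` M) B"
  unfolding maximal_subalg_def
proof (intro conjI allI impI)
  have MS: "subalg K M A" "M \<noteq> carrier A"
    and max: "\<And>H. \<lbrakk>subalg K H A; M \<subseteq> H\<rbrakk> \<Longrightarrow> H = M \<or> H = carrier A"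
    using M by (auto simp: maximal_subalg_def)
  have pre: "{x \<in> carrier A. f x \<in> f ` M} = M" using MS(1) ker by (rule preimage_image)
  show "subalg K (f ` M) B" using MS(1) by (rule subalg_image)
  show "f ` M \<noteq> carrier B" using pre MS(2) by auto
  fix H assume "subalg K H B \<and> f ` M \<subseteq> H"
  then have H: "subalg K H B" "f ` M \<subseteq> H" by auto
  have disj: "{x \<in> carrier A. f x \<in> H} = M \<or> {x \<in> carrier A. f x \<in> H} = carrier A"
    using H A.subalgD(1)[OF MS(1)] by (intro max subalg_preimage) auto
  have eq: "f ` {x \<in> carrier A. f x \<in> H} = H"
    using B.subalgD(1)[OF H(1)] by (intro image_preimage) auto
  from disj show "H = f ` M \<or> H = carrier B"
    by (rule disjE) (use eq surj in simp_all)
qed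

text \<open>The preimage of a maximal subalgebra is maximal, so an element common to all maximal subalgebras
  of \<open>A\<close> maps into every maximal subalgebra of \<open>B\<close>.\<close>

lemma frattini_image: "f ` frattini_subalg K A \<subseteq> frattini_subalg K B"
proof
  fix u assume "u \<in> f ` frattini_subalg K A"
  then obtain x where x: "x \<in> frattini_subalg K A" "u = f x" by blast
  show "u \<in> frattini_subalg K B"
    using A.frattini_subalgD[OF x(1)] x(2) maximal_preimage
    by (intro B.frattini_subalgI) auto
qed

text \<open>Here every maximal subalgebra of \<open>A\<close> contains the kernel, hence is the preimage of a maximal
  subalgebra of \<open>B\<close>.\<close>

lemma frattini_preimage:
  assumes ker: "a_kernel A B f \<subseteq> frattini_subalg K A"
    and x: "x \<in> carrier A" "f x \<in> frattini_subalg K B"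
  shows "x \<in> frattini_subalg K A"
proof (rule A.frattini_subalgI[OF x(1)])
  fix M assume M: "maximal_subalg K M A"
  then have kM: "a_kernel A B f \<subseteq> M" using ker A.frattini_subalgD(2) by blast
  then have fx: "f x \<in> f ` M" using B.frattini_subalgD(2)[OF x(2)] maximal_image M by blast
  have "{x \<in> carrier A. f x \<in> f ` M} = M"
    using M kM by (intro preimage_image) (simp_all add: maximal_subalg_def)
  then show "x \<in> M" using x(1) fx by blast
qed

end

lemma (in nonassoc_algebra) ideal_subset_frattini_ideal_iff:
  "alg_ideal K N A \<Longrightarrow> N \<subseteq> frattini_ideal K A \<longleftrightarrow> N \<subseteq> frattini_subalg K A"
  using frattini_ideal_greatest by blast

lemma frattini_kernel_comp:
  assumes "alg_epi K A B f" "alg_epi K B C g"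
    and "a_kernel A B f \<subseteq> frattini_subalg K A" "a_kernel B C g \<subseteq> frattini_subalg K B"
  shows "a_kernel A C (g \<circ> f) \<subseteq> frattini_subalg K A"
proof
  interpret f: alg_epi K A B f by fact
  fix x assume "x \<in> a_kernel A C (g \<circ> f)"
  then have "x \<in> carrier A" "f x \<in> a_kernel B C g" by (auto simp: a_kernel_def')
  then show "x \<in> frattini_subalg K A" using f.frattini_preimage assms by blast
qed

subsection \<open>Frattini extensions as epimorphisms\<close>

text \<open>
  The operations on cosets are unions over all representatives. By \<open>congruent_mod_ideal\<close> all terms of
  such a union are the same coset.
\<close>

lemma quot_alg_projection:
  fixes A :: "('k, 'a) module"
  assumes A: "nonassoc_algebra K A" and N: "alg_ideal K N A"
  shows "alg_epi K A (quot_alg A N) (\<lambda>x. N +>\<^bsub>A\<^esub> x)"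
    and "a_kernel A (quot_alg A N) (\<lambda>x. N +>\<^bsub>A\<^esub> x) = N"
proof -
  interpret nonassoc_algebra K A by fact
  note NS = subalgD[OF alg_idealD(1)[OF N]]
  interpret abelian_subgroup N A
    using N submodule.axioms(1)[of N K A] by (intro abelian_subgroupI3)
      (auto simp: alg_ideal_def additive_subgroup_def M.abelian_group_axioms)
  have mem: "y \<in> carrier A" "N +>\<^bsub>A\<^esub> y = N +>\<^bsub>A\<^esub> x" if "x \<in> carrier A" "y \<in> N +>\<^bsub>A\<^esub> x" for x y
    using a_elemrcos_carrier[OF that] a_repr_independence'[OF that(2,1)] by auto
  have self: "x \<in> N +>\<^bsub>A\<^esub> x" if "x \<in> carrier A" for x
    using that by (rule a_rcos_self)
  have iff: "N +>\<^bsub>A\<^esub> x = N +>\<^bsub>A\<^esub> y \<longleftrightarrow> x \<ominus>\<^bsub>A\<^esub> y \<in> N" if xy: "x \<in> carrier A" "y \<in> carrier A" for x y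
    using a_rcos_module_imp[OF xy(2)] a_rcos_module_rev[OF xy(2,1)] self[OF xy(1)] mem(2)[OF xy(2)]
    by (metis a_minus_def)
  have hom: "(\<lambda>x. N +>\<^bsub>A\<^esub> x) \<in> alg_hom K A (quot_alg A N)"
  proof (rule alg_homI)
    fix x assume x: "x \<in> carrier A"
    then show "N +>\<^bsub>A\<^esub> x \<in> carrier (quot_alg A N)"
      by (auto simp: quot_alg_def A_RCOSETS_def')
    show "N +>\<^bsub>A\<^esub> (a \<odot>\<^bsub>A\<^esub> x) = a \<odot>\<^bsub>quot_alg A N\<^esub> (N +>\<^bsub>A\<^esub> x)" if a: "a \<in> carrier K" for a
    proof -
      have "N +>\<^bsub>A\<^esub> (a \<odot>\<^bsub>A\<^esub> y) = N +>\<^bsub>A\<^esub> (a \<odot>\<^bsub>A\<^esub> x)" if "y \<in> N +>\<^bsub>A\<^esub> x" for y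
        using congruent_mod_ideal(1)[OF N] iff mem[OF x that] x a by simp
      then have "(\<Union>y\<in>N +>\<^bsub>A\<^esub> x. N +>\<^bsub>A\<^esub> (a \<odot>\<^bsub>A\<^esub> y)) = N +>\<^bsub>A\<^esub> (a \<odot>\<^bsub>A\<^esub> x)"
        using self[OF x] by (intro SUP_eq_const) blast+
      then show ?thesis by (simp add: quot_alg_def)
    qed
    fix y assume y: "y \<in> carrier A"
    show "N +>\<^bsub>A\<^esub> (x \<oplus>\<^bsub>A\<^esub> y) = (N +>\<^bsub>A\<^esub> x) \<oplus>\<^bsub>quot_alg A N\<^esub> (N +>\<^bsub>A\<^esub> y)"
      using x y a_rcos_sum by (simp add: quot_alg_def)
    have "N +>\<^bsub>A\<^esub> (u \<otimes>\<^bsub>A\<^esub> v) = N +>\<^bsub>A\<^esub> (x \<otimes>\<^bsub>A\<^esub> y)"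
      if "u \<in> N +>\<^bsub>A\<^esub> x" "v \<in> N +>\<^bsub>A\<^esub> y" for u v
      using congruent_mod_ideal(3)[OF N] iff mem[OF x that(1)] mem[OF y that(2)] x y
      by (simp add: mult_closed)
    then have "(\<Union>u\<in>N +>\<^bsub>A\<^esub> x. \<Union>v\<in>N +>\<^bsub>A\<^esub> y. N +>\<^bsub>A\<^esub> (u \<otimes>\<^bsub>A\<^esub> v)) = N +>\<^bsub>A\<^esub> (x \<otimes>\<^bsub>A\<^esub> y)"
      using self[OF x] self[OF y] by (intro SUP_eq_const) blast+
    then show "N +>\<^bsub>A\<^esub> (x \<otimes>\<^bsub>A\<^esub> y) = (N +>\<^bsub>A\<^esub> x) \<otimes>\<^bsub>quot_alg A N\<^esub> (N +>\<^bsub>A\<^esub> y)"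
      by (simp add: quot_alg_def rcoset_mult_def)
  qed
  have zero: "N +>\<^bsub>A\<^esub> \<zero>\<^bsub>A\<^esub> = N"
    using a_coset_add_zero[OF a_subset] by simp
  have surj: "(\<lambda>x. N +>\<^bsub>A\<^esub> x) ` carrier A = carrier (quot_alg A N)"
    by (auto simp: quot_alg_def A_RCOSETS_def')
  show "alg_epi K A (quot_alg A N) (\<lambda>x. N +>\<^bsub>A\<^esub> x)"
    using A hom zero surj by (intro alg_epiI) (simp_all add: quot_alg_def)
  have "N +>\<^bsub>A\<^esub> x = N \<longleftrightarrow> x \<in> N" if "x \<in> carrier A" for x
  proof -
    have "x \<ominus>\<^bsub>A\<^esub> \<zero>\<^bsub>A\<^esub> = x" using that by (simp add: a_minus_def)
    then show ?thesis using that iff[of x "\<zero>\<^bsub>A\<^esub>"] zero by simp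
  qed
  then have "{x \<in> carrier A. N +>\<^bsub>A\<^esub> x = N} = N" using NS(1) by blast
  then show "a_kernel A (quot_alg A N) (\<lambda>x. N +>\<^bsub>A\<^esub> x) = N"
    by (simp add: a_kernel_def' quot_alg_def)
qed

text \<open>
  The kernel of a homomorphism is an ideal, and an ideal lies in the Frattini ideal as soon as it
  lies in the Frattini subalgebra. The latter is an intersection of maximal subalgebras and thus
  the easier one to work with.
\<close>

lemma op_E_Phi_iff:
  assumes U: "U \<subseteq> all_algebras K" and X: "X \<subseteq> U"
  shows "A \<in> op_E_Phi K U X \<longleftrightarrow>
    A \<in> U \<and> (\<exists>B\<in>X. \<exists>f. alg_epi K A B f \<and> a_kernel A B f \<subseteq> frattini_subalg K A)"
proof (cases "A \<in> U")
  case True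
  then interpret A: nonassoc_algebra K A using U by (auto simp: all_algebras_def)
  have algB: "nonassoc_algebra K B" if "B \<in> X" for B
    using that U X by (auto simp: all_algebras_def)
  have "(\<exists>N. alg_ideal K N A \<and> N \<subseteq> frattini_ideal K A \<and> alg_iso K (quot_alg A N) B) \<longleftrightarrow>
    (\<exists>f. alg_epi K A B f \<and> a_kernel A B f \<subseteq> frattini_subalg K A)" (is "?L \<longleftrightarrow> ?R")
    if B: "B \<in> X" for B
  proof
    assume ?L
    then obtain N where N: "alg_ideal K N A" "N \<subseteq> frattini_ideal K A"
      "alg_iso K (quot_alg A N) B" by blast
    note proj = quot_alg_projection[OF A.nonassoc_algebra_axioms N(1)]
    then interpret q: alg_epi K A "quot_alg A N" "\<lambda>x. N +>\<^bsub>A\<^esub> x" by simp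
    obtain f where f: "alg_epi K (quot_alg A N) B f" "inj_on f (carrier (quot_alg A N))"
      using N(3) alg_iso_iff[OF q.B.nonassoc_algebra_axioms algB[OF B]] by blast
    interpret f: alg_epi K "quot_alg A N" B f by fact
    have "a_kernel A B (f \<circ> (\<lambda>x. N +>\<^bsub>A\<^esub> x)) \<subseteq> N"
      using f.inj_on_iff f(2) q.map_closed by (subst proj(2)[symmetric]) (auto simp: a_kernel_def')
    then show ?R using alg_epi_comp[OF proj(1) f(1)] N A.frattini_ideal_greatest(2) by blast
  next
    assume ?R
    then obtain f where f: "alg_epi K A B f" "a_kernel A B f \<subseteq> frattini_subalg K A" by blast
    interpret f: alg_epi K A B f by fact
    let ?N = "a_kernel A B f"
    note N = f.ideal_kernel
    note proj = quot_alg_projection[OF A.nonassoc_algebra_axioms N]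
    then interpret q: alg_epi K A "quot_alg A ?N" "\<lambda>x. ?N +>\<^bsub>A\<^esub> x" by simp
    obtain h where h: "alg_morphism K (quot_alg A ?N) B h"
      "\<And>x. x \<in> carrier A \<Longrightarrow> h (?N +>\<^bsub>A\<^esub> x) = f x"
      using q.factor_through[of B f] f.alg_morphism_axioms proj(2) by auto
    interpret h: alg_morphism K "quot_alg A ?N" B h by fact
    have "h ` carrier (quot_alg A ?N) = carrier B"
      unfolding q.surj[symmetric] f.surj[symmetric] by (auto simp: h(2) image_image)
    moreover have "inj_on h (carrier (quot_alg A ?N))"
      unfolding h.inj_on_iff
    proof (intro ballI impI)
      fix u assume u: "u \<in> carrier (quot_alg A ?N)" "h u = \<zero>\<^bsub>B\<^esub>"
      then obtain x where x: "x \<in> carrier A" "u = ?N +>\<^bsub>A\<^esub> x" using q.preimage_exists by blast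
      then have "x \<in> a_kernel A (quot_alg A ?N) (\<lambda>x. ?N +>\<^bsub>A\<^esub> x)"
        using u h(2) unfolding proj(2) by (simp add: a_kernel_def')
      then show "u = \<zero>\<^bsub>quot_alg A ?N\<^esub>" using x by (simp add: a_kernel_def')
    qed
    ultimately have "alg_iso K (quot_alg A ?N) B"
      using h.hom by (auto simp: alg_iso_def bij_betw_def)
    then show ?L using N f(2) A.ideal_subset_frattini_ideal_iff by blast
  qed
  then show ?thesis using True by (simp add: op_E_Phi_def) blast
qed (simp add: op_E_Phi_def)

section \<open>Finite direct products\<close>

text \<open>
  A direct product is described by its projections, so that it can be recognised inside the given
  type: nothing is said about how its elements are encoded.
\<close>

locale product_cone = A: nonassoc_algebra K A
  for K :: "('k, 'm) ring_scheme" and A :: "('k, 'a) module" +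
  fixes J :: "'i set" and H :: "'i \<Rightarrow> ('k, 'b) module" and p :: "'i \<Rightarrow> 'a \<Rightarrow> 'b"
  assumes finite_index: "finite J"
    and proj: "j \<in> J \<Longrightarrow> alg_morphism K A (H j) (p j)"
    and proj_eqI: "\<lbrakk>x \<in> carrier A; y \<in> carrier A; \<And>j. j \<in> J \<Longrightarrow> p j x = p j y\<rbrakk> \<Longrightarrow> x = y"
    and proj_exists: "(\<And>j. j \<in> J \<Longrightarrow> h j \<in> carrier (H j)) \<Longrightarrow>
      \<exists>x. x \<in> carrier A \<and> (\<forall>j\<in>J. p j x = h j)"
begin

lemma factor_algebra: "j \<in> J \<Longrightarrow> nonassoc_algebra K (H j)"
  using proj by (simp add: alg_morphism_def)

lemma mediating_morphism:
  assumes C: "nonassoc_algebra K C" and g: "\<And>j. j \<in> J \<Longrightarrow> alg_morphism K C (H j) (g j)"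
  obtains f where "alg_morphism K C A f"
    "\<And>j x. \<lbrakk>j \<in> J; x \<in> carrier C\<rbrakk> \<Longrightarrow> p j (f x) = g j x"
proof -
  interpret C: nonassoc_algebra K C by fact
  define f where "f x = (SOME y. y \<in> carrier A \<and> (\<forall>j\<in>J. p j y = g j x))" for x
  have f: "f x \<in> carrier A \<and> (\<forall>j\<in>J. p j (f x) = g j x)" if "x \<in> carrier C" for x
    unfolding f_def
    by (rule someI_ex, rule proj_exists) (use that alg_morphism.map_closed[OF g] in blast)
  have "f \<in> alg_hom K C A"
  proof (rule alg_homI)
    fix x assume x: "x \<in> carrier C"
    then show "f x \<in> carrier A" using f by blast
    show "f (a \<odot>\<^bsub>C\<^esub> x) = a \<odot>\<^bsub>A\<^esub> f x" if a: "a \<in> carrier K" for a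
    proof (rule proj_eqI)
      fix j assume j: "j \<in> J"
      interpret p: alg_morphism K A "H j" "p j" using j by (rule proj)
      interpret g: alg_morphism K C "H j" "g j" using j by (rule g)
      show "p j (f (a \<odot>\<^bsub>C\<^esub> x)) = p j (a \<odot>\<^bsub>A\<^esub> f x)"
        using f x a j by simp
    qed (use f x a in auto)
    fix y assume y: "y \<in> carrier C"
    show "f (x \<oplus>\<^bsub>C\<^esub> y) = f x \<oplus>\<^bsub>A\<^esub> f y"
    proof (rule proj_eqI)
      fix j assume j: "j \<in> J"
      interpret p: alg_morphism K A "H j" "p j" using j by (rule proj)
      interpret g: alg_morphism K C "H j" "g j" using j by (rule g)
      show "p j (f (x \<oplus>\<^bsub>C\<^esub> y)) = p j (f x \<oplus>\<^bsub>A\<^esub> f y)"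
        using f x y j by simp
    qed (use f x y in auto)
    show "f (x \<otimes>\<^bsub>C\<^esub> y) = f x \<otimes>\<^bsub>A\<^esub> f y"
    proof (rule proj_eqI)
      fix j assume j: "j \<in> J"
      interpret p: alg_morphism K A "H j" "p j" using j by (rule proj)
      interpret g: alg_morphism K C "H j" "g j" using j by (rule g)
      show "p j (f (x \<otimes>\<^bsub>C\<^esub> y)) = p j (f x \<otimes>\<^bsub>A\<^esub> f y)"
        using f x y j by (simp add: C.mult_closed)
    qed (use f x y in \<open>auto simp: C.mult_closed A.mult_closed\<close>)
  qed
  then have "alg_morphism K C A f" by unfold_locales
  then show thesis using f that by blast
qed

definition summand :: "'i \<Rightarrow> 'a set" where
  "summand j = {x \<in> carrier A. \<forall>i\<in>J. i \<noteq> j \<longrightarrow> p i x = \<zero>\<^bsub>H i\<^esub>}"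

lemma summand_carrier: "x \<in> summand j \<Longrightarrow> x \<in> carrier A"
  by (simp add: summand_def)

lemma summand_ideal: "alg_ideal K (summand j) A"
proof -
  have K: "alg_ideal K (a_kernel A (H i) (p i)) A" if "i \<in> J" for i
    using alg_morphism.ideal_kernel[OF proj[OF that]] .
  have eq: "x \<in> summand j \<longleftrightarrow> x \<in> carrier A \<and> (\<forall>i\<in>J - {j}. x \<in> a_kernel A (H i) (p i))" for x
    by (auto simp: summand_def a_kernel_def')
  note KI = A.alg_idealD[OF K] and KS = A.subalgD[OF A.alg_idealD(1)[OF K]]
  show ?thesis
    by (intro A.alg_idealI A.subalgI)
      (use KI KS in \<open>simp_all add: eq subset_iff A.mult_closed\<close>)
qed

lemma summand_eqI:
  assumes "j \<in> J" "x \<in> summand j" "y \<in> summand j" "p j x = p j y"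
  shows "x = y"
proof (rule proj_eqI)
  show "p i x = p i y" if "i \<in> J" for i
    using assms that by (cases "i = j") (auto simp: summand_def)
qed (use assms summand_carrier in auto)

lemma summand_exists:
  assumes "j \<in> J" "h \<in> carrier (H j)"
  shows "\<exists>x. x \<in> summand j \<and> p j x = h"
proof -
  have "\<exists>x. x \<in> carrier A \<and> (\<forall>i\<in>J. p i x = (if i = j then h else \<zero>\<^bsub>H i\<^esub>))"
  proof (rule proj_exists)
    fix i assume "i \<in> J"
    then interpret nonassoc_algebra K "H i" by (rule factor_algebra)
    show "(if i = j then h else \<zero>\<^bsub>H i\<^esub>) \<in> carrier (H i)" using assms by auto
  qed
  then show ?thesis using assms by (auto simp: summand_def)
qed

lemma proj_finsum:
  assumes i: "i \<in> J" and y: "\<And>j. j \<in> J \<Longrightarrow> y j \<in> summand j"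
  shows "p i (finsum A y J) = p i (y i)"
proof -
  interpret p: alg_morphism K A "H i" "p i" using i by (rule proj)
  have yC: "y j \<in> carrier A" if "j \<in> J" for j using y that by (simp add: summand_def)
  have "p i (finsum A y J) = (\<Oplus>\<^bsub>H i\<^esub>j\<in>J. p i (y j))" using yC by (intro p.map_finsum) auto
  also have "\<dots> = (\<Oplus>\<^bsub>H i\<^esub>j\<in>J. if i = j then p i (y j) else \<zero>\<^bsub>H i\<^esub>)"
    using y i yC by (intro p.B.M.finsum_cong') (auto simp: summand_def)
  also have "\<dots> = p i (y i)"
    using i finite_index yC by (intro p.B.M.finsum_singleton) auto
  finally show ?thesis .
qed

lemma decomposition:
  assumes "x \<in> carrier A" "\<And>j. j \<in> J \<Longrightarrow> y j \<in> summand j \<and> p j (y j) = p j x"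
  shows "x = finsum A y J"
  using assms proj_finsum[of _ y] by (intro proj_eqI A.M.finsum_closed) (auto simp: summand_def)

text \<open>Membership in a subspace can be tested on the components in the summands.\<close>

lemma submodule_by_components:
  assumes S: "submodule S K A" and x: "x \<in> carrier A"
    and comp: "\<And>j y. \<lbrakk>j \<in> J; y \<in> summand j; p j y = p j x\<rbrakk> \<Longrightarrow> y \<in> S"
  shows "x \<in> S"
proof -
  have "\<exists>y. y \<in> summand j \<and> p j y = p j x" if "j \<in> J" for j
    using summand_exists[OF that] alg_morphism.map_closed[OF proj[OF that] x] by blast
  then obtain y where y: "\<And>j. j \<in> J \<Longrightarrow> y j \<in> summand j \<and> p j (y j) = p j x" by metis
  then have "finsum A y J \<in> S" using comp by (intro A.submodule_finsum[OF S]) blast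
  then show ?thesis using decomposition[OF x y] by simp
qed

lemma proj_epi:
  assumes j: "j \<in> J"
  shows "alg_epi K (A\<lparr>carrier := summand j\<rparr>) (H j) (p j)"
    and "inj_on (p j) (summand j)"
proof -
  interpret p: alg_morphism K A "H j" "p j" using j by (rule proj)
  let ?I = "A\<lparr>carrier := summand j\<rparr>"
  note SI = A.subalgD[OF A.alg_idealD(1)[OF summand_ideal]]
  show inj: "inj_on (p j) (summand j)"
    using summand_eqI[OF j] by (blast intro: inj_onI)
  have im: "p j ` summand j = carrier (H j)"
    using summand_exists[OF j] SI(1) by fastforce
  have "p j \<in> alg_hom K ?I (H j)"
    using SI by (intro alg_homI) auto
  define h where "h = inv_into (summand j) (p j)"
  have h: "h (p j x) = x" if "x \<in> summand j" for x
    using that inj by (simp add: h_def)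
  have ex: "\<exists>x. x \<in> summand j \<and> u = p j x" if "u \<in> carrier (H j)" for u
    using that im by blast
  have "h \<in> alg_hom K (H j) ?I"
    by (intro alg_homI)
      (auto dest!: ex simp: h SI simp flip: p.map_add p.map_mult p.map_smult)
  moreover have "h \<zero>\<^bsub>H j\<^esub> = \<zero>\<^bsub>?I\<^esub>" using h[of "\<zero>\<^bsub>A\<^esub>"] SI(2) by simp
  moreover have "h ` carrier (H j) = carrier ?I"
    using h unfolding im[symmetric] image_image by simp
  ultimately have "nonassoc_algebra K ?I"
    using algebra_surjective_image[OF p.B.nonassoc_algebra_axioms] by blast
  then show "alg_epi K ?I (H j) (p j)"
    using \<open>p j \<in> alg_hom K ?I (H j)\<close> im by (intro alg_epiI) simp_all
qed

lemma reindex: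
  assumes b: "bij_betw b I J"
  shows "product_cone K A I (H \<circ> b) (p \<circ> b)"
proof (intro product_cone.intro product_cone_axioms.intro)
  show "nonassoc_algebra K A" by (rule A.nonassoc_algebra_axioms)
  have bJ: "b i \<in> J" if "i \<in> I" for i using b that by (auto simp: bij_betw_def)
  show "finite I" using b finite_index bij_betw_finite by blast
  show "alg_morphism K A ((H \<circ> b) i) ((p \<circ> b) i)" if "i \<in> I" for i
    using proj[OF bJ[OF that]] by simp
  show "x = y" if "x \<in> carrier A" "y \<in> carrier A" "\<And>i. i \<in> I \<Longrightarrow> (p \<circ> b) i x = (p \<circ> b) i y" for x y
    using that b by (intro proj_eqI) (auto simp: bij_betw_def)
  show "\<exists>x. x \<in> carrier A \<and> (\<forall>i\<in>I. (p \<circ> b) i x = h i)"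
    if h: "\<And>i. i \<in> I \<Longrightarrow> h i \<in> carrier ((H \<circ> b) i)" for h
  proof -
    have inv: "inv_into I b (b i) = i" if "i \<in> I" for i
      using b that by (simp add: bij_betw_def)
    have "\<exists>x. x \<in> carrier A \<and> (\<forall>j\<in>J. p j x = h (inv_into I b j))"
    proof (rule proj_exists)
      fix j assume "j \<in> J"
      then obtain i where "i \<in> I" "j = b i" using b by (auto simp: bij_betw_def)
      then show "h (inv_into I b j) \<in> carrier (H j)" using h[of i] inv by simp
    qed
    then show ?thesis using bJ inv by auto
  qed
qed

end

subsection \<open>Existence in an infinite type\<close>

text \<open>Adding one more coordinate amounts to a pairing function on the infinite type.\<close>

lemma finite_power_injection:
  assumes inf: "infinite (UNIV :: 'a set)" and "finite J"
  shows "\<exists>\<phi> :: ('i \<Rightarrow> 'a) \<Rightarrow> 'a. inj_on \<phi> (J \<rightarrow>\<^sub>E UNIV)"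
  using assms(2)
proof induction
  case empty
  then show ?case by simp
next
  case (insert j J)
  then obtain \<phi> :: "('i \<Rightarrow> 'a) \<Rightarrow> 'a" where \<phi>: "inj_on \<phi> (J \<rightarrow>\<^sub>E UNIV)" by blast
  obtain c :: "'a \<times> 'a \<Rightarrow> 'a" where c: "inj c"
    using card_of_Times_same_infinite[OF inf, THEN ordIso_imp_ordLeq]
    by (auto simp flip: card_of_ordLeq)
  have "inj_on (\<lambda>f. c (f j, \<phi> (restrict f J))) (insert j J \<rightarrow>\<^sub>E UNIV)"
  proof (rule inj_onI)
    fix f g :: "'i \<Rightarrow> 'a"
    assume fg: "f \<in> insert j J \<rightarrow>\<^sub>E UNIV" "g \<in> insert j J \<rightarrow>\<^sub>E UNIV"
      and "c (f j, \<phi> (restrict f J)) = c (g j, \<phi> (restrict g J))"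
    then have eq: "f j = g j" "\<phi> (restrict f J) = \<phi> (restrict g J)"
      using c by (auto dest: injD)
    then have "restrict f J = restrict g J" using \<phi> by (auto dest: inj_onD)
    then have "f i = g i" if "i \<in> J" for i using that by (metis restrict_apply')
    then show "f = g" using fg eq(1) by (intro PiE_ext[OF fg]) auto
  qed
  then show ?case by blast
qed

lemma product_cone_exists:
  fixes H :: "'i \<Rightarrow> ('k, 'a) module"
  assumes inf: "infinite (UNIV :: 'a set)" and J: "finite J" "J \<noteq> {}"
    and alg: "\<And>j. j \<in> J \<Longrightarrow> nonassoc_algebra K (H j)"
  obtains P :: "('k, 'a) module" and p where "product_cone K P J H p"
proof -
  define T :: "('k, 'i \<Rightarrow> 'a) module" where
    "T = \<lparr>carrier = \<Pi>\<^sub>E j\<in>J. carrier (H j), mult = (\<lambda>f g. \<lambda>j\<in>J. f j \<otimes>\<^bsub>H j\<^esub> g j),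
      one = (\<lambda>j\<in>J. \<one>\<^bsub>H j\<^esub>), zero = (\<lambda>j\<in>J. \<zero>\<^bsub>H j\<^esub>), add = (\<lambda>f g. \<lambda>j\<in>J. f j \<oplus>\<^bsub>H j\<^esub> g j),
      smult = (\<lambda>a f. \<lambda>j\<in>J. a \<odot>\<^bsub>H j\<^esub> f j)\<rparr>"
  have grp: "abelian_group (H j)" and mdl: "module K (H j)" if "j \<in> J" for j
    using alg[OF that] by (auto simp: nonassoc_algebra_def module_def)
  obtain j0 where j0: "j0 \<in> J" using J(2) by blast
  interpret j0: nonassoc_algebra K "H j0" using alg j0 .
  note AG = abelian_group.axioms(1)[OF grp] and M = mdl and N = alg
  have mem: "f \<in> carrier T \<longleftrightarrow> f \<in> extensional J \<and> (\<forall>j\<in>J. f j \<in> carrier (H j))" for f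
    by (auto simp: T_def PiE_iff)
  have ops [simp]: "f \<otimes>\<^bsub>T\<^esub> g = (\<lambda>j\<in>J. f j \<otimes>\<^bsub>H j\<^esub> g j)" "f \<oplus>\<^bsub>T\<^esub> g = (\<lambda>j\<in>J. f j \<oplus>\<^bsub>H j\<^esub> g j)"
    "a \<odot>\<^bsub>T\<^esub> f = (\<lambda>j\<in>J. a \<odot>\<^bsub>H j\<^esub> f j)" "\<zero>\<^bsub>T\<^esub> = (\<lambda>j\<in>J. \<zero>\<^bsub>H j\<^esub>)" for a f g
    by (simp_all add: T_def)
  have ext: "f = g" if "f \<in> extensional J" "g \<in> extensional J" "\<And>j. j \<in> J \<Longrightarrow> f j = g j" for f g :: "'i \<Rightarrow> 'a"
    using that by (rule extensionalityI)
  have "abelian_group T"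
  proof (rule abelian_groupI)
    fix f assume f: "f \<in> carrier T"
    have "(\<lambda>j\<in>J. \<ominus>\<^bsub>H j\<^esub> f j) \<in> carrier T"
      using f by (auto simp: mem intro!: abelian_group.a_inv_closed[OF grp])
    moreover have "(\<lambda>j\<in>J. \<ominus>\<^bsub>H j\<^esub> f j) \<oplus>\<^bsub>T\<^esub> f = \<zero>\<^bsub>T\<^esub>"
      using f by (auto simp: mem abelian_group.l_neg[OF grp] intro!: ext)
    ultimately show "\<exists>g\<in>carrier T. g \<oplus>\<^bsub>T\<^esub> f = \<zero>\<^bsub>T\<^esub>" by blast
  qed (auto simp: mem abelian_monoid.a_closed[OF AG] abelian_monoid.a_assoc[OF AG]
      abelian_monoid.zero_closed[OF AG] abelian_monoid.l_zero[OF AG]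
      intro!: ext abelian_monoid.a_comm[OF AG])
  then have "module K T"
    by (intro moduleI module.axioms(1)[OF j0.module_axioms])
      (auto simp: mem module.smult_closed[OF M] module.smult_l_distr[OF M]
        module.smult_r_distr[OF M] module.smult_assoc1[OF M] module.smult_one[OF M] intro!: ext)
  moreover have "nonassoc_algebra_axioms K T"
    by unfold_locales
      (auto simp: mem nonassoc_algebra.mult_closed[OF N] nonassoc_algebra.mult_l_distr[OF N]
        nonassoc_algebra.mult_r_distr[OF N] nonassoc_algebra.smult_mult_l[OF N]
        nonassoc_algebra.smult_mult_r[OF N] intro!: ext)
  ultimately have T: "nonassoc_algebra K T"
    using j0.field_axioms by (simp add: nonassoc_algebra_def)
  obtain \<phi> :: "('i \<Rightarrow> 'a) \<Rightarrow> 'a" where \<phi>: "inj_on \<phi> (J \<rightarrow>\<^sub>E UNIV)"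
    using finite_power_injection[OF inf J(1)] by blast
  then have \<phi>T: "inj_on \<phi> (carrier T)"
    by (rule inj_on_subset) (auto simp: T_def)
  obtain P :: "('k, 'a) module" where P: "alg_epi K T P \<phi>"
    using transfer_algebra[OF T \<phi>T] .
  obtain h where h: "alg_epi K P T h" "inj_on h (carrier P)"
    using alg_epi_inverse[OF P \<phi>T] by blast
  interpret h: alg_epi K P T h by fact
  have "product_cone K P J H (\<lambda>j u. h u j)"
  proof (intro product_cone.intro product_cone_axioms.intro)
    show "alg_morphism K P (H j) (\<lambda>u. h u j)" if "j \<in> J" for j
      using that h.map_closed alg h.A.nonassoc_algebra_axioms
      by (intro alg_morphism.intro alg_morphism_axioms.intro alg_homI) (auto simp: mem)
    show "x = y" if xy: "x \<in> carrier P" "y \<in> carrier P" and "\<And>j. j \<in> J \<Longrightarrow> h x j = h y j" for x y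
    proof -
      have "h x = h y" using that h.map_closed by (intro ext) (auto simp: mem)
      then show ?thesis using h(2) xy by (auto dest: inj_onD)
    qed
    show "\<exists>x. x \<in> carrier P \<and> (\<forall>j\<in>J. h x j = g j)"
      if g: "\<And>j. j \<in> J \<Longrightarrow> g j \<in> carrier (H j)" for g
    proof -
      have "restrict g J \<in> carrier T" using g by (auto simp: mem)
      then obtain x where "x \<in> carrier P" "restrict g J = h x" using h.preimage_exists by blast
      then show ?thesis by (metis restrict_apply')
    qed
  qed (use J(1) h.A.nonassoc_algebra_axioms in auto)
  then show thesis by (rule that)
qed

section \<open>Direct sums of ideals\<close>

context nonassoc_algebra
begin

lemma mult_finsum_right:
  assumes "x \<in> carrier A" "g \<in> J \<rightarrow> carrier A"
  shows "x \<otimes>\<^bsub>A\<^esub> finsum A g J = (\<Oplus>\<^bsub>A\<^esub>j\<in>J. x \<otimes>\<^bsub>A\<^esub> g j)"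
  using assms(2)
  by (induction J rule: infinite_finite_induct)
    (use assms(1) in \<open>auto simp: Pi_def mult_closed mult_r_distr\<close>)

lemma mult_finsum_left:
  assumes "x \<in> carrier A" "g \<in> J \<rightarrow> carrier A"
  shows "finsum A g J \<otimes>\<^bsub>A\<^esub> x = (\<Oplus>\<^bsub>A\<^esub>j\<in>J. g j \<otimes>\<^bsub>A\<^esub> x)"
  using assms(2)
  by (induction J rule: infinite_finite_induct)
    (use assms(1) in \<open>auto simp: Pi_def mult_closed mult_l_distr\<close>)

end

text \<open>
  The coordinate maps of an internal direct sum are linear by uniqueness of the decomposition. They
  are multiplicative because distinct summands \<open>I i\<close>, \<open>I k\<close> annihilate each other: a product lies in
  both ideals, and \<open>I i\<close> and \<open>I k\<close> intersect trivially.
\<close>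

lemma direct_sum_product_cone:
  assumes A: "nonassoc_algebra K A" and sum: "is_direct_sum K A r I"
    and sub: "\<And>j. j \<in> {1..r} \<Longrightarrow> nonassoc_algebra K (A\<lparr>carrier := I j\<rparr>)"
  obtains p where "product_cone K A {1..r} (\<lambda>j. A\<lparr>carrier := I j\<rparr>) p"
proof -
  interpret A: nonassoc_algebra K A by fact
  let ?J = "{1..r}"
  have ideal: "alg_ideal K (I j) A" if "j \<in> ?J" for j
    using sum that by (simp add: is_direct_sum_def)
  note IS = A.subalgD[OF A.alg_idealD(1)[OF ideal]]
  define D where "D x = (THE f. f \<in> (\<Pi>\<^sub>E j\<in>?J. I j) \<and> x = finsum A f ?J)" for x
  have ex1: "\<exists>!f. f \<in> (\<Pi>\<^sub>E j\<in>?J. I j) \<and> x = finsum A f ?J" if "x \<in> carrier A" for x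
    using sum that by (simp add: is_direct_sum_def)
  have D: "D x \<in> (\<Pi>\<^sub>E j\<in>?J. I j) \<and> x = finsum A (D x) ?J" if "x \<in> carrier A" for x
    unfolding D_def using theI'[OF ex1[OF that]] .
  have DI: "D x j \<in> I j" "D x j \<in> carrier A" if "x \<in> carrier A" "j \<in> ?J" for x j
    using PiE_mem[OF conjunct1[OF D[OF that(1)]] that(2)] IS(1)[OF that(2)] by auto
  have Dsum: "x = finsum A (D x) ?J" if "x \<in> carrier A" for x
    using D[OF that] by blast
  have D_finsum: "D (finsum A f ?J) j = f j"
    if f: "\<And>j. j \<in> ?J \<Longrightarrow> f j \<in> I j" and j: "j \<in> ?J" for f j
  proof -
    have fC: "f \<in> ?J \<rightarrow> carrier A" using f IS(1) by blast
    have "finsum A f ?J = finsum A (restrict f ?J) ?J"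
      using fC by (intro A.M.finsum_cong') auto
    moreover have "restrict f ?J \<in> (\<Pi>\<^sub>E j\<in>?J. I j)" using f by auto
    moreover have "finsum A f ?J \<in> carrier A" using fC by simp
    ultimately have "D (finsum A f ?J) = restrict f ?J"
      unfolding D_def by (intro the1_equality[OF ex1]) auto
    then show ?thesis using j by simp
  qed
  have orth: "u \<otimes>\<^bsub>A\<^esub> v = \<zero>\<^bsub>A\<^esub>"
    if ik: "i \<in> ?J" "k \<in> ?J" "i \<noteq> k" and uv: "u \<in> I i" "v \<in> I k" for i k u v
  proof -
    define w where "w = u \<otimes>\<^bsub>A\<^esub> v"
    have w: "w \<in> I i" "w \<in> I k" "w \<in> carrier A"
      using A.alg_idealD(3)[OF ideal] A.alg_idealD(2)[OF ideal] IS(1) ik uv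
      by (auto simp: w_def A.mult_closed)
    \<comment> \<open>Two decompositions of \<open>w\<close>: one concentrated at \<open>i\<close>, the other at \<open>k\<close>.\<close>
    have single: "w = (\<Oplus>\<^bsub>A\<^esub>j\<in>?J. if l = j then w else \<zero>\<^bsub>A\<^esub>)"
      and single_D: "D w i = (if l = i then w else \<zero>\<^bsub>A\<^esub>)" if l: "l \<in> ?J" "w \<in> I l" for l
    proof -
      show eq: "w = (\<Oplus>\<^bsub>A\<^esub>j\<in>?J. if l = j then w else \<zero>\<^bsub>A\<^esub>)"
        using l w(3) A.M.finsum_singleton[of l ?J "\<lambda>_. w"] by simp
      show "D w i = (if l = i then w else \<zero>\<^bsub>A\<^esub>)"
        by (subst eq, subst D_finsum) (use l IS(2) ik in auto)
    qed
    show ?thesis using single_D[OF ik(1) w(1)] single_D[OF ik(2) w(2)] ik(3) by (simp add: w_def)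
  qed
  have add: "D (x \<oplus>\<^bsub>A\<^esub> y) j = D x j \<oplus>\<^bsub>A\<^esub> D y j"
    if "x \<in> carrier A" "y \<in> carrier A" "j \<in> ?J" for x y j
  proof -
    have "x \<oplus>\<^bsub>A\<^esub> y = (\<Oplus>\<^bsub>A\<^esub>j\<in>?J. D x j \<oplus>\<^bsub>A\<^esub> D y j)"
      using DI that Dsum[OF that(1)] Dsum[OF that(2)] by (subst A.M.finsum_addf) auto
    then show ?thesis using D_finsum[of "\<lambda>j. D x j \<oplus>\<^bsub>A\<^esub> D y j" j] DI IS(4) that by simp
  qed
  have smult: "D (a \<odot>\<^bsub>A\<^esub> x) j = a \<odot>\<^bsub>A\<^esub> D x j"
    if "a \<in> carrier K" "x \<in> carrier A" "j \<in> ?J" for a x j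
  proof -
    have "a \<odot>\<^bsub>A\<^esub> x = (\<Oplus>\<^bsub>A\<^esub>j\<in>?J. a \<odot>\<^bsub>A\<^esub> D x j)"
      using DI that Dsum[OF that(2)] by (subst A.finsum_smult_ldistr[symmetric]) auto
    then show ?thesis using D_finsum[of "\<lambda>j. a \<odot>\<^bsub>A\<^esub> D x j" j] DI IS(6) that by simp
  qed
  have mult: "D (x \<otimes>\<^bsub>A\<^esub> y) j = D x j \<otimes>\<^bsub>A\<^esub> D y j"
    if x: "x \<in> carrier A" and y: "y \<in> carrier A" and j: "j \<in> ?J" for x y j
  proof -
    \<comment> \<open>Only the \<open>i\<close>-th component of \<open>x\<close> contributes to the product with the \<open>i\<close>-th component of \<open>y\<close>.\<close>
    have row: "x \<otimes>\<^bsub>A\<^esub> D y i = D x i \<otimes>\<^bsub>A\<^esub> D y i" if i: "i \<in> ?J" for i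
    proof -
      have "x \<otimes>\<^bsub>A\<^esub> D y i = (\<Oplus>\<^bsub>A\<^esub>k\<in>?J. D x k \<otimes>\<^bsub>A\<^esub> D y i)"
        using DI x y i by (subst Dsum[OF x]) (intro A.mult_finsum_left, auto)
      also have "\<dots> = (\<Oplus>\<^bsub>A\<^esub>k\<in>?J. if i = k then D x k \<otimes>\<^bsub>A\<^esub> D y i else \<zero>\<^bsub>A\<^esub>)"
        using DI x y i orth by (intro A.M.finsum_cong') (auto simp: A.mult_closed)
      also have "\<dots> = D x i \<otimes>\<^bsub>A\<^esub> D y i"
        using DI x y i A.mult_closed
          A.M.finsum_singleton[of i ?J "\<lambda>k. D x k \<otimes>\<^bsub>A\<^esub> D y i"] by auto
      finally show ?thesis .
    qed
    have "x \<otimes>\<^bsub>A\<^esub> y = (\<Oplus>\<^bsub>A\<^esub>i\<in>?J. x \<otimes>\<^bsub>A\<^esub> D y i)"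
      using DI x y by (subst Dsum[OF y]) (intro A.mult_finsum_right, auto)
    also have "\<dots> = (\<Oplus>\<^bsub>A\<^esub>i\<in>?J. D x i \<otimes>\<^bsub>A\<^esub> D y i)"
      using DI x y row by (intro A.M.finsum_cong') (auto simp: A.mult_closed)
    finally show ?thesis
      using D_finsum[of "\<lambda>i. D x i \<otimes>\<^bsub>A\<^esub> D y i" j] DI IS(7) that by simp
  qed
  have "product_cone K A ?J (\<lambda>j. A\<lparr>carrier := I j\<rparr>) (\<lambda>j x. D x j)"
  proof (intro product_cone.intro product_cone_axioms.intro)
    show "alg_morphism K A (A\<lparr>carrier := I j\<rparr>) (\<lambda>x. D x j)" if "j \<in> ?J" for j
      using A sub[OF that] DI add mult smult that
      by (intro alg_morphism.intro alg_morphism_axioms.intro alg_homI) auto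
    show "x = y" if xy: "x \<in> carrier A" "y \<in> carrier A" and "\<And>j. j \<in> ?J \<Longrightarrow> D x j = D y j" for x y
    proof -
      have "D x = D y" using D xy that(3) by (intro PiE_ext[of "D x" ?J I "D y"]) auto
      then show ?thesis using Dsum xy by metis
    qed
    show "\<exists>x. x \<in> carrier A \<and> (\<forall>j\<in>?J. D x j = h j)"
      if h: "\<And>j. j \<in> ?J \<Longrightarrow> h j \<in> carrier (A\<lparr>carrier := I j\<rparr>)" for h
      using h IS(1) D_finsum[of h] by (intro exI[of _ "finsum A h ?J"]) auto
  qed (use A in auto)
  then show thesis by (rule that)
qed

lemma is_direct_sum_summands:
  assumes "product_cone K A {1..r} H p"
  shows "is_direct_sum K A r (product_cone.summand A {1..r} H p)"
  unfolding is_direct_sum_def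
proof (intro conjI ballI)
  interpret product_cone K A "{1..r}" H p by fact
  show "alg_ideal K (summand j) A" for j by (rule summand_ideal)
  fix x assume x: "x \<in> carrier A"
  have "\<exists>y. y \<in> summand j \<and> p j y = p j x" if "j \<in> {1..r}" for j
    using summand_exists[OF that] alg_morphism.map_closed[OF proj[OF that] x] by blast
  then obtain y where y: "\<And>j. j \<in> {1..r} \<Longrightarrow> y j \<in> summand j \<and> p j (y j) = p j x" by metis
  let ?f = "restrict y {1..r}"
  show "\<exists>!f. f \<in> (\<Pi>\<^sub>E j\<in>{1..r}. summand j) \<and> x = finsum A f {1..r}"
  proof (intro ex1I[of _ ?f] conjI)
    show "?f \<in> (\<Pi>\<^sub>E j\<in>{1..r}. summand j)" using y by auto
    show "x = finsum A ?f {1..r}" by (rule decomposition[OF x]) (use y in auto)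
    fix f assume f: "f \<in> (\<Pi>\<^sub>E j\<in>{1..r}. summand j) \<and> x = finsum A f {1..r}"
    then have fs: "f j \<in> summand j" if "j \<in> {1..r}" for j using that by (auto simp: PiE_mem)
    show "f = ?f"
    proof (rule PiE_ext)
      show "f \<in> (\<Pi>\<^sub>E j\<in>{1..r}. summand j)" using f by blast
      show "?f \<in> (\<Pi>\<^sub>E j\<in>{1..r}. summand j)" using y by auto
      fix j assume j: "j \<in> {1..r}"
      then have "p j (f j) = p j (y j)" using proj_finsum[OF j fs] f y by simp
      then show "f j = ?f j" using summand_eqI[OF j fs[OF j]] y j by simp
    qed
  qed
qed

section \<open>The Frattini subalgebra of a direct product\<close>

text \<open>The property through which finite dimension enters the study of maximal subalgebras of products.\<close>

definition coatomic_subalgebras :: "('k, 'm) ring_scheme \<Rightarrow> ('k, 'a) module \<Rightarrow> bool" where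
  "coatomic_subalgebras K A \<longleftrightarrow>
    (\<forall>H. subalg K H A \<and> H \<noteq> carrier A \<longrightarrow> (\<exists>M. maximal_subalg K M A \<and> H \<subseteq> M))"

context nonassoc_algebra
begin

lemma subalg_Int: "subalg K H A \<Longrightarrow> subalg K L A \<Longrightarrow> subalg K (H \<inter> L) A"
  using subalgD[of H] subalgD[of L] by (intro subalgI) auto

lemma subalg_add_ideal:
  assumes M: "subalg K M A" and N: "alg_ideal K N A"
  shows "subalg K {x \<oplus>\<^bsub>A\<^esub> y | x y. x \<in> M \<and> y \<in> N} A" (is "subalg K ?S A")
proof (rule subalgI)
  note MS = subalgD[OF M] and NI = alg_idealD[OF N]
  note NS = subalgD[OF NI(1)]
  show "?S \<subseteq> carrier A" using MS(1) NS(1) by auto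
  show "\<zero>\<^bsub>A\<^esub> \<in> ?S" using MS(2) NS(2) by force
  fix u assume "u \<in> ?S"
  then obtain x y where u: "u = x \<oplus>\<^bsub>A\<^esub> y" "x \<in> M" "y \<in> N" by auto
  then have xy: "x \<in> carrier A" "y \<in> carrier A" using MS(1) NS(1) by auto
  show "a \<odot>\<^bsub>A\<^esub> u \<in> ?S" if a: "a \<in> carrier K" for a
    using smult_r_distr[OF a xy] u MS(6)[OF a] NS(6)[OF a] by blast
  fix v assume "v \<in> ?S"
  then obtain x' y' where v: "v = x' \<oplus>\<^bsub>A\<^esub> y'" "x' \<in> M" "y' \<in> N" by auto
  then have xy': "x' \<in> carrier A" "y' \<in> carrier A" using MS(1) NS(1) by auto
  have "u \<oplus>\<^bsub>A\<^esub> v = (x \<oplus>\<^bsub>A\<^esub> x') \<oplus>\<^bsub>A\<^esub> (y \<oplus>\<^bsub>A\<^esub> y')"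
    using xy xy' u(1) v(1) by (simp add: M.a_ac)
  then show "u \<oplus>\<^bsub>A\<^esub> v \<in> ?S" using MS(4) NS(4) u v by blast
  have "u \<otimes>\<^bsub>A\<^esub> v = x \<otimes>\<^bsub>A\<^esub> x' \<oplus>\<^bsub>A\<^esub> (x \<otimes>\<^bsub>A\<^esub> y' \<oplus>\<^bsub>A\<^esub> y \<otimes>\<^bsub>A\<^esub> v)"
    using xy xy' u(1) v(1) by (simp add: mult_l_distr mult_r_distr mult_closed M.a_ac)
  moreover have "x \<otimes>\<^bsub>A\<^esub> x' \<in> M" using MS(7) u v by blast
  moreover have "x \<otimes>\<^bsub>A\<^esub> y' \<oplus>\<^bsub>A\<^esub> y \<otimes>\<^bsub>A\<^esub> v \<in> N"
    using NI(2)[OF v(3) xy(1)] NI(3)[OF u(3)] xy' v(1) NS(4) by simp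
  ultimately show "u \<otimes>\<^bsub>A\<^esub> v \<in> ?S" by blast
qed

end

context product_cone
begin

text \<open>
  Let \<open>N'\<close> be the copy of \<open>N\<close> in the \<open>j\<close>-th summand \<open>S\<close>, an ideal of \<open>A\<close>. If a maximal subalgebra \<open>M\<close>
  of \<open>A\<close> misses an element of \<open>N'\<close>, then \<open>M + N' = A\<close>, and the modular law gives
  \<open>S = (M \<inter> S) + N'\<close>. Elements of the Frattini subalgebra cannot help to generate, so this forces
  \<open>M \<inter> S = S\<close>: otherwise a maximal subalgebra of \<open>H j\<close> above the image of \<open>M \<inter> S\<close> would contain \<open>N\<close> as
  well, hence everything. But then \<open>N'\<close> lies in \<open>M\<close> after all.
\<close>

lemma component_in_frattini:
  assumes j: "j \<in> J" and coat: "coatomic_subalgebras K (H j)"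
    and N: "alg_ideal K N (H j)" "N \<subseteq> frattini_subalg K (H j)"
    and y: "y \<in> summand j" "p j y \<in> N"
  shows "y \<in> frattini_subalg K A"
proof (rule A.frattini_subalgI)
  show "y \<in> carrier A" using y(1) by (rule summand_carrier)
  interpret p: alg_morphism K A "H j" "p j" using j by (rule proj)
  fix M assume M: "maximal_subalg K M A"
  then have MS: "subalg K M A"
    and max: "\<And>L. \<lbrakk>subalg K L A; M \<subseteq> L\<rbrakk> \<Longrightarrow> L = M \<or> L = carrier A"
    by (auto simp: maximal_subalg_def)
  note MD = A.subalgD[OF MS] and ND = p.B.subalgD[OF p.B.alg_idealD(1)[OF N(1)]]
    and NI = p.B.alg_idealD[OF N(1)]
  note SI = A.alg_idealD[OF summand_ideal[of j]]
  note SD = A.subalgD[OF SI(1)]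
  define N' where "N' = {z \<in> summand j. p j z \<in> N}"
  have N': "alg_ideal K N' A"
    using SD SI ND NI by (intro A.alg_idealI A.subalgI) (auto simp: N'_def)
  have N'D: "z \<in> N' \<Longrightarrow> z \<in> summand j" "z \<in> N' \<Longrightarrow> p j z \<in> N" for z
    by (auto simp: N'_def)
  show "y \<in> M"
  proof (rule ccontr)
    assume yM: "y \<notin> M"
    let ?S = "{x \<oplus>\<^bsub>A\<^esub> z | x z. x \<in> M \<and> z \<in> N'}"
    have S: "subalg K ?S A" using MS N' by (rule A.subalg_add_ideal)
    have "M \<subseteq> ?S"
    proof
      fix x assume "x \<in> M"
      then show "x \<in> ?S"
        using A.subalgD(2)[OF A.alg_idealD(1)[OF N']] MD(1) A.M.r_zero[of x] by force
    qed
    moreover have "y \<in> ?S"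
      using y summand_carrier[OF y(1)] MD(2) A.M.l_zero[of y] N'_def by force
    ultimately have SC: "?S = carrier A" using max[OF S] yM by blast
    \<comment> \<open>The summand is carried to \<open>H j\<close>, where maximal subalgebras are available.\<close>
    define L where "L = p j ` (M \<inter> summand j)"
    have L: "subalg K L (H j)"
      unfolding L_def using MS SI(1) by (intro p.subalg_image A.subalg_Int)
    have "L \<noteq> carrier (H j)"
    proof
      assume "L = carrier (H j)"
      then have "p j y \<in> L" using SD(1)[OF y(1)] by simp
      then obtain z where "z \<in> M" "z \<in> summand j" "p j y = p j z" by (auto simp: L_def)
      then show False using summand_eqI[OF j y(1), of z] yM by simp
    qed
    then obtain M' where M': "maximal_subalg K M' (H j)" "L \<subseteq> M'"
      using coat L by (auto simp: coatomic_subalgebras_def)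
    have M'D: "\<lbrakk>u \<in> M'; v \<in> M'\<rbrakk> \<Longrightarrow> u \<oplus>\<^bsub>H j\<^esub> v \<in> M'" for u v
      using M'(1) p.B.subalgD(4) by (auto simp: maximal_subalg_def)
    have NM': "N \<subseteq> M'" using N(2) p.B.frattini_subalgD(2) M'(1) by blast
    have "carrier (H j) \<subseteq> M'"
    proof
      fix h assume "h \<in> carrier (H j)"
      then obtain z where z: "z \<in> summand j" "p j z = h" using summand_exists[OF j] by blast
      then have "z \<in> ?S" using SC SD(1) by blast
      \<comment> \<open>The modular law: \<open>m = z - n\<close> lies in the summand as well.\<close>
      then obtain m n where mn: "z = m \<oplus>\<^bsub>A\<^esub> n" "m \<in> M" "n \<in> N'" by auto
      have C: "m \<in> carrier A" "n \<in> carrier A" using mn MD(1) N'D(1) SD(1) by auto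
      then have "m = z \<ominus>\<^bsub>A\<^esub> n" by (simp add: mn(1) a_minus_def A.M.a_assoc A.M.r_neg)
      then have "m \<in> summand j" using SD(5) z(1) N'D(1)[OF mn(3)] by simp
      then have "p j m \<in> M'" using mn(2) M'(2) by (auto simp: L_def)
      moreover have "p j n \<in> M'" using N'D(2)[OF mn(3)] NM' by blast
      ultimately have "p j m \<oplus>\<^bsub>H j\<^esub> p j n \<in> M'" by (rule M'D)
      then show "h \<in> M'" using z(2) mn(1) C by simp
    qed
    moreover have "M' \<subseteq> carrier (H j)" "M' \<noteq> carrier (H j)"
      using M'(1) p.B.subalgD(1) by (auto simp: maximal_subalg_def)
    ultimately show False by blast
  qed
qed

lemma frattini_by_components:
  assumes x: "x \<in> carrier A"
    and coat: "\<And>j. j \<in> J \<Longrightarrow> coatomic_subalgebras K (H j)"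
    and N: "\<And>j. j \<in> J \<Longrightarrow> alg_ideal K (N j) (H j)"
      "\<And>j. j \<in> J \<Longrightarrow> N j \<subseteq> frattini_subalg K (H j)"
    and px: "\<And>j. j \<in> J \<Longrightarrow> p j x \<in> N j"
  shows "x \<in> frattini_subalg K A"
  using A.submodule_frattini x
proof (rule submodule_by_components)
  fix j y assume "j \<in> J" "y \<in> summand j" "p j y = p j x"
  then show "y \<in> frattini_subalg K A"
    using component_in_frattini[OF _ coat N] px by metis
qed

end

section \<open>Finite-dimensional algebras\<close>

lemma (in nonassoc_algebra) linear_combinations_submodule:
  assumes "finite B" "B \<subseteq> carrier A"
  shows "submodule {\<Oplus>\<^bsub>A\<^esub>b\<in>B. c b \<odot>\<^bsub>A\<^esub> b | c. c \<in> B \<rightarrow> carrier K} K A" (is "submodule ?S K A")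
proof -
  have cl: "(\<lambda>b. c b \<odot>\<^bsub>A\<^esub> b) \<in> B \<rightarrow> carrier A" if "c \<in> B \<rightarrow> carrier K" for c
    using that assms(2) by auto
  have SC: "?S \<subseteq> carrier A" using cl by auto
  have smult: "a \<odot>\<^bsub>A\<^esub> x \<in> ?S" if a: "a \<in> carrier K" and x: "x \<in> ?S" for a x
  proof -
    obtain c where c: "c \<in> B \<rightarrow> carrier K" "x = (\<Oplus>\<^bsub>A\<^esub>b\<in>B. c b \<odot>\<^bsub>A\<^esub> b)" using x by auto
    have "a \<odot>\<^bsub>A\<^esub> x = (\<Oplus>\<^bsub>A\<^esub>b\<in>B. a \<odot>\<^bsub>A\<^esub> (c b \<odot>\<^bsub>A\<^esub> b))"
      using finsum_smult_ldistr[OF assms(1) a cl[OF c(1)]] c(2) by simp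
    also have "\<dots> = (\<Oplus>\<^bsub>A\<^esub>b\<in>B. (a \<otimes>\<^bsub>K\<^esub> c b) \<odot>\<^bsub>A\<^esub> b)"
      using a c(1) assms(2) by (intro M.finsum_cong') (auto simp: smult_assoc1 Pi_def)
    finally show ?thesis using a c(1) by (intro CollectI exI[of _ "\<lambda>b. a \<otimes>\<^bsub>K\<^esub> c b"]) auto
  qed
  have zero: "(\<Oplus>\<^bsub>A\<^esub>b\<in>B. \<zero>\<^bsub>K\<^esub> \<odot>\<^bsub>A\<^esub> b) = \<zero>\<^bsub>A\<^esub>"
  proof -
    have "(\<Oplus>\<^bsub>A\<^esub>b\<in>B. \<zero>\<^bsub>K\<^esub> \<odot>\<^bsub>A\<^esub> b) = (\<Oplus>\<^bsub>A\<^esub>b\<in>B. \<zero>\<^bsub>A\<^esub>)"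
      using assms(2) by (intro M.finsum_cong') auto
    then show ?thesis by simp
  qed
  show ?thesis
  proof (rule submoduleI[OF SC])
    show "\<zero>\<^bsub>A\<^esub> \<in> ?S" using zero by (intro CollectI exI[of _ "\<lambda>_. \<zero>\<^bsub>K\<^esub>"]) auto
    show "\<ominus>\<^bsub>A\<^esub> x \<in> ?S" if x: "x \<in> ?S" for x
    proof -
      have "x \<in> carrier A" using x SC by blast
      then have "\<ominus>\<^bsub>A\<^esub> x = (\<ominus>\<^bsub>K\<^esub> \<one>\<^bsub>K\<^esub>) \<odot>\<^bsub>A\<^esub> x" by (simp add: smult_l_minus)
      then show ?thesis using smult[of "\<ominus>\<^bsub>K\<^esub> \<one>\<^bsub>K\<^esub>" x] x by simp
    qed
    fix x y assume "x \<in> ?S" "y \<in> ?S"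
    then obtain c d where c: "c \<in> B \<rightarrow> carrier K" "x = (\<Oplus>\<^bsub>A\<^esub>b\<in>B. c b \<odot>\<^bsub>A\<^esub> b)"
      and d: "d \<in> B \<rightarrow> carrier K" "y = (\<Oplus>\<^bsub>A\<^esub>b\<in>B. d b \<odot>\<^bsub>A\<^esub> b)" by auto
    have "x \<oplus>\<^bsub>A\<^esub> y = (\<Oplus>\<^bsub>A\<^esub>b\<in>B. c b \<odot>\<^bsub>A\<^esub> b \<oplus>\<^bsub>A\<^esub> d b \<odot>\<^bsub>A\<^esub> b)"
      using M.finsum_addf[OF cl[OF c(1)] cl[OF d(1)]] c(2) d(2) by simp
    also have "\<dots> = (\<Oplus>\<^bsub>A\<^esub>b\<in>B. (c b \<oplus>\<^bsub>K\<^esub> d b) \<odot>\<^bsub>A\<^esub> b)"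
      using c(1) d(1) assms(2) by (intro M.finsum_cong') (auto simp: smult_l_distr Pi_def)
    finally show "x \<oplus>\<^bsub>A\<^esub> y \<in> ?S"
      using c(1) d(1) by (intro CollectI exI[of _ "\<lambda>b. c b \<oplus>\<^bsub>K\<^esub> d b"]) auto
  qed (rule smult)
qed

text \<open>
  A set spans iff no proper subspace contains it. In this form spanning sets pass to images and
  products by taking images and preimages of subspaces, without any computation with coefficients.
\<close>

lemma (in nonassoc_algebra) finite_dimensionalE:
  assumes "finite_dimensional K A"
  obtains B where "finite B" "B \<subseteq> carrier A"
    "\<And>S. \<lbrakk>submodule S K A; B \<subseteq> S\<rbrakk> \<Longrightarrow> S = carrier A"
proof -
  obtain B where B: "finite B" "B \<subseteq> carrier A" and
    span: "\<forall>x\<in>carrier A. \<exists>c\<in>B \<rightarrow> carrier K. x = (\<Oplus>\<^bsub>A\<^esub>b\<in>B. c b \<odot>\<^bsub>A\<^esub> b)"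
    using assms unfolding finite_dimensional_def by (elim exE conjE) (rule that)
  have "S = carrier A" if S: "submodule S K A" "B \<subseteq> S" for S
  proof
    show "S \<subseteq> carrier A" using submoduleE(1)[OF S(1)] .
    show "carrier A \<subseteq> S"
    proof
      fix x assume "x \<in> carrier A"
      then obtain c where c: "c \<in> B \<rightarrow> carrier K" "x = (\<Oplus>\<^bsub>A\<^esub>b\<in>B. c b \<odot>\<^bsub>A\<^esub> b)" using span by blast
      have "c b \<odot>\<^bsub>A\<^esub> b \<in> S" if "b \<in> B" for b
        using submoduleE(4)[OF S(1)] c(1) S(2) that by blast
      then show "x \<in> S"
        using submodule_finsum[OF S(1), of B "\<lambda>b. c b \<odot>\<^bsub>A\<^esub> b"] c(2) by simp
    qed
  qed
  with B show thesis by (rule that)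
qed

lemma (in nonassoc_algebra) finite_dimensionalI:
  assumes B: "finite B" "B \<subseteq> carrier A"
    and gen: "\<And>S. \<lbrakk>submodule S K A; B \<subseteq> S\<rbrakk> \<Longrightarrow> S = carrier A"
  shows "finite_dimensional K A"
proof -
  let ?S = "{\<Oplus>\<^bsub>A\<^esub>b\<in>B. c b \<odot>\<^bsub>A\<^esub> b | c. c \<in> B \<rightarrow> carrier K}"
  have "b \<in> ?S" if b: "b \<in> B" for b
  proof -
    have "b = (\<Oplus>\<^bsub>A\<^esub>d\<in>B. if b = d then d else \<zero>\<^bsub>A\<^esub>)"
      using B(2) by (intro M.finsum_singleton[OF b B(1), symmetric]) auto
    also have "\<dots> = (\<Oplus>\<^bsub>A\<^esub>d\<in>B. (if b = d then \<one>\<^bsub>K\<^esub> else \<zero>\<^bsub>K\<^esub>) \<odot>\<^bsub>A\<^esub> d)"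
      using B(2) by (intro M.finsum_cong') auto
    finally show ?thesis
      by (intro CollectI exI[of _ "\<lambda>d. if b = d then \<one>\<^bsub>K\<^esub> else \<zero>\<^bsub>K\<^esub>"]) auto
  qed
  then have "B \<subseteq> ?S" by (rule subsetI)
  then have S: "?S = carrier A" by (rule gen[OF linear_combinations_submodule[OF B]])
  show "finite_dimensional K A"
    unfolding finite_dimensional_def
  proof (intro exI[of _ B] conjI ballI)
    fix x assume "x \<in> carrier A"
    then have "x \<in> ?S" by (simp only: S)
    then show "\<exists>c\<in>B \<rightarrow> carrier K. x = (\<Oplus>\<^bsub>A\<^esub>b\<in>B. c b \<odot>\<^bsub>A\<^esub> b)" by auto
  qed (use B in auto)
qed

lemma (in alg_epi) finite_dimensional_image:
  assumes "finite_dimensional K A"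
  shows "finite_dimensional K B"
proof -
  obtain G where G: "finite G" "G \<subseteq> carrier A"
    and gen: "\<And>S. \<lbrakk>submodule S K A; G \<subseteq> S\<rbrakk> \<Longrightarrow> S = carrier A"
    using A.finite_dimensionalE[OF assms] by metis
  have "S = carrier B" if S: "submodule S K B" "f ` G \<subseteq> S" for S
  proof -
    have pre: "{x \<in> carrier A. f x \<in> S} = carrier A"
      using S G(2) by (intro gen submodule_preimage) auto
    have "carrier B \<subseteq> S"
    proof
      fix u assume "u \<in> carrier B"
      then obtain x where x: "x \<in> carrier A" "u = f x" using preimage_exists by blast
      then have "x \<in> {x \<in> carrier A. f x \<in> S}" by (simp only: pre)
      then show "u \<in> S" using x by simp
    qed
    then show ?thesis using B.submoduleE(1)[OF S(1)] by blast
  qed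
  then show ?thesis
    using G by (intro B.finite_dimensionalI[of "f ` G"]) auto
qed

lemma (in product_cone) finite_dimensional_product:
  assumes "\<And>j. j \<in> J \<Longrightarrow> finite_dimensional K (H j)"
  shows "finite_dimensional K A"
proof -
  have "\<exists>G. finite G \<and> G \<subseteq> carrier (H j) \<and> (\<forall>S. submodule S K (H j) \<and> G \<subseteq> S \<longrightarrow> S = carrier (H j))"
    if "j \<in> J" for j
    using nonassoc_algebra.finite_dimensionalE[OF factor_algebra[OF that] assms[OF that]] by metis
  then obtain G where G: "\<And>j. j \<in> J \<Longrightarrow> finite (G j) \<and> G j \<subseteq> carrier (H j)"
    and gen: "\<And>j S. \<lbrakk>j \<in> J; submodule S K (H j); G j \<subseteq> S\<rbrakk> \<Longrightarrow> S = carrier (H j)"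
    by metis
  define E where "E = (\<Union>j\<in>J. {x \<in> summand j. p j x \<in> G j})"
  have "finite {x \<in> summand j. p j x \<in> G j}" if j: "j \<in> J" for j
  proof (rule inj_on_finite)
    show "inj_on (p j) {x \<in> summand j. p j x \<in> G j}"
      by (rule inj_on_subset[OF proj_epi(2)[OF j]]) auto
  qed (use G[OF j] in auto)
  then have "finite E" using finite_index by (simp add: E_def)
  moreover have "E \<subseteq> carrier A" by (auto simp: E_def summand_def)
  moreover have "S = carrier A" if S: "submodule S K A" "E \<subseteq> S" for S
  proof
    show "S \<subseteq> carrier A" using A.submoduleE(1)[OF S(1)] .
    have SI: "summand j \<subseteq> S" if j: "j \<in> J" for j
    proof
      fix x assume x: "x \<in> summand j"
      interpret p: alg_morphism K A "H j" "p j" using j by (rule proj)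
      have I: "submodule (summand j) K A" using summand_ideal[of j] by (simp add: alg_ideal_def)
      note D = A.submoduleE[OF S(1)] A.submoduleE[OF I]
        subgroup.one_closed[OF submodule.axioms(1)[OF S(1)]]
        subgroup.one_closed[OF submodule.axioms(1)[OF I]]
      have "submodule (S \<inter> summand j) K A"
        by (rule A.submoduleI) (use D in auto)
      then have "submodule (p j ` (S \<inter> summand j)) K (H j)" by (rule p.submodule_image)
      moreover have "G j \<subseteq> p j ` (S \<inter> summand j)"
      proof
        fix h assume h: "h \<in> G j"
        then obtain z where "z \<in> summand j" "p j z = h" using summand_exists[OF j] G[OF j] by blast
        then show "h \<in> p j ` (S \<inter> summand j)" using S(2) h j by (auto simp: E_def)
      qed
      ultimately have "p j ` (S \<inter> summand j) = carrier (H j)" using gen[OF j] by blast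
      then have "p j x \<in> p j ` (S \<inter> summand j)" using x summand_carrier by auto
      then obtain z where "z \<in> S" "z \<in> summand j" "p j x = p j z" by blast
      then show "x \<in> S" using summand_eqI[OF j x] by metis
    qed
    show "carrier A \<subseteq> S" using submodule_by_components[OF S(1)] SI by blast
  qed
  ultimately show ?thesis by (rule A.finite_dimensionalI)
qed

text \<open>
  Zorn's lemma applies because a finite spanning set contained in the union of a chain is already
  contained in one of its members, so a union of proper subalgebras is proper.
\<close>

lemma (in nonassoc_algebra) finite_dimensional_coatomic:
  assumes "finite_dimensional K A"
  shows "coatomic_subalgebras K A"
  unfolding coatomic_subalgebras_def
proof (intro allI impI)
  obtain G where G: "finite G" "G \<subseteq> carrier A"
    and gen: "\<And>S. \<lbrakk>submodule S K A; G \<subseteq> S\<rbrakk> \<Longrightarrow> S = carrier A"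
    using finite_dimensionalE[OF assms] by metis
  fix H assume H: "subalg K H A \<and> H \<noteq> carrier A"
  let ?P = "{S. subalg K S A \<and> H \<subseteq> S \<and> S \<noteq> carrier A}"
  have "\<exists>M\<in>?P. \<forall>S\<in>?P. M \<subseteq> S \<longrightarrow> S = M"
  proof (rule subset_Zorn_nonempty)
    show "?P \<noteq> {}" using H by blast
    fix C assume C: "C \<noteq> {}" "subset.chain ?P C"
    then have CP: "C \<subseteq> ?P" by (auto simp: subset.chain_def)
    then have mem: "subalg K S A" if "S \<in> C" for S using that by blast
    have dir: "\<exists>S\<in>C. x \<in> S \<and> y \<in> S" if "x \<in> \<Union>C" "y \<in> \<Union>C" for x y
    proof -
      have "finite {x, y}" "{x, y} \<subseteq> \<Union>C" using that by auto
      then obtain S where "S \<in> C" "{x, y} \<subseteq> S"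
        using finite_subset_Union_chain[OF _ _ C] by metis
      then show ?thesis by blast
    qed
    have "subalg K (\<Union>C) A"
    proof (rule subalgI)
      show "\<Union>C \<subseteq> carrier A" using subalgD(1)[OF mem] by blast
      show "\<zero>\<^bsub>A\<^esub> \<in> \<Union>C" using subalgD(2)[OF mem] C(1) by blast
      show "a \<odot>\<^bsub>A\<^esub> x \<in> \<Union>C" if "a \<in> carrier K" "x \<in> \<Union>C" for a x
        using subalgD(6)[OF mem] that by blast
      fix x y assume "x \<in> \<Union>C" "y \<in> \<Union>C"
      then obtain S where S: "S \<in> C" "x \<in> S" "y \<in> S" using dir by blast
      then show "x \<oplus>\<^bsub>A\<^esub> y \<in> \<Union>C" "x \<otimes>\<^bsub>A\<^esub> y \<in> \<Union>C"
        using subalgD(4,7)[OF mem[OF S(1)]] by blast+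
    qed
    moreover have "H \<subseteq> \<Union>C" using C(1) CP by blast
    moreover have "\<Union>C \<noteq> carrier A"
    proof
      assume "\<Union>C = carrier A"
      then have "G \<subseteq> \<Union>C" using G(2) by simp
      then obtain S where S: "S \<in> C" "G \<subseteq> S"
        using finite_subset_Union_chain[OF G(1) _ C] by metis
      then have "S = carrier A" using mem by (intro gen) (simp_all add: subalg_def)
      then show False using S(1) CP by blast
    qed
    ultimately show "\<Union>C \<in> ?P" by blast
  qed
  then obtain M where M: "M \<in> ?P" and max: "\<forall>S\<in>?P. M \<subseteq> S \<longrightarrow> S = M"
    by (elim bexE) (rule that)
  have "maximal_subalg K M A"
    unfolding maximal_subalg_def
  proof (intro conjI allI impI)
    fix S assume S: "subalg K S A \<and> M \<subseteq> S"
    show "S = M \<or> S = carrier A"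
    proof (cases "S = carrier A")
      case False
      then have "S \<in> ?P" using S M by auto
      then show ?thesis using max S by simp
    qed simp
  qed (use M in auto)
  then show "\<exists>M. maximal_subalg K M A \<and> H \<subseteq> M" using M by blast
qed

section \<open>Universes of algebras\<close>

text \<open>
  The properties shared by the class of all algebras and the class of finite-dimensional ones, so
  that both are treated at once. Infinity of the type makes room for products. Natural numbers as
  indices are enough, since only finite products occur.
\<close>

locale algebra_universe =
  fixes K :: "('k, 'm) ring_scheme" and U :: "('k, 'a) module set"
  assumes infinite_type: "infinite (UNIV :: 'a set)"
    and algebras: "A \<in> U \<Longrightarrow> nonassoc_algebra K A"
    and epi_closed: "\<lbrakk>A \<in> U; alg_epi K A B f\<rbrakk> \<Longrightarrow> B \<in> U"
    and nat_product_closed: "\<lbrakk>product_cone K A J H p; \<And>j :: nat. j \<in> J \<Longrightarrow> H j \<in> U\<rbrakk> \<Longrightarrow> A \<in> U"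
begin

lemma subset_all_algebras: "U \<subseteq> all_algebras K"
  using algebras by (auto simp: all_algebras_def)

lemma product_closed:
  assumes "product_cone K A J H p" "\<And>j. j \<in> J \<Longrightarrow> H j \<in> U"
  shows "A \<in> U"
proof -
  interpret product_cone K A J H p by fact
  obtain e where e: "bij_betw e {1..card J} J"
    using ex_bij_betw_nat_finite_1[OF finite_index] by blast
  show ?thesis
    by (rule nat_product_closed[OF reindex[OF e]]) (use assms(2) bij_betwE[OF e] in simp)
qed

lemma product_exists:
  fixes H :: "'i \<Rightarrow> ('k, 'a) module"
  assumes "finite J" "J \<noteq> {}" "\<And>j. j \<in> J \<Longrightarrow> H j \<in> U"
  obtains P :: "('k, 'a) module" and p where "product_cone K P J H p" "P \<in> U"
  using product_cone_exists[OF infinite_type assms(1,2)] algebras product_closed assms(3) by metis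

lemma alg_class_subset: "alg_class K U X \<Longrightarrow> X \<subseteq> U"
  by (simp add: alg_class_def)

lemma alg_class_iso:
  assumes "alg_class K U X" "A \<in> X" "alg_epi K A B f" "inj_on f (carrier A)"
  shows "B \<in> X"
proof -
  have A: "A \<in> U" using assms alg_class_subset by blast
  then have B: "B \<in> U" using epi_closed assms(3) by blast
  then show ?thesis
    using assms alg_iso_iff[OF algebras[OF A] algebras[OF B]] by (auto simp: alg_class_def)
qed

lemma closure_operationI:
  assumes sub: "\<And>X. C X \<subseteq> U" and empty: "C {} = {}"
    and iso: "\<And>X A B f. \<lbrakk>alg_class K U X; A \<in> C X; B \<in> U; alg_epi K B A f; inj_on f (carrier B)\<rbrakk>
      \<Longrightarrow> B \<in> C X"
    and ext: "\<And>X. alg_class K U X \<Longrightarrow> X \<subseteq> C X"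
    and mono: "\<And>X Y. X \<subseteq> Y \<Longrightarrow> C X \<subseteq> C Y"
    and idem: "\<And>X. alg_class K U X \<Longrightarrow> alg_class K U (C X) \<Longrightarrow> C (C X) \<subseteq> C X"
  shows "closure_operation K U C"
proof -
  have cls: "alg_class K U (C X)" if X: "alg_class K U X" for X
    unfolding alg_class_def
  proof (intro conjI ballI impI)
    fix A B assume A: "A \<in> C X" and B: "B \<in> U" and "alg_iso K A B"
    have AU: "A \<in> U" using A sub by blast
    obtain f where f: "alg_epi K A B f" "inj_on f (carrier A)"
      using \<open>alg_iso K A B\<close> alg_iso_iff[OF algebras[OF AU] algebras[OF B]] by blast
    obtain h where "alg_epi K B A h" "inj_on h (carrier B)"
      using alg_epi_inverse[OF f] by metis
    then show "B \<in> C X" using iso[OF X A B] by blast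
  qed (rule sub)
  then show ?thesis
    using empty ext mono idem unfolding closure_operation_def by (simp add: subset_antisym)
qed

subsection \<open>The operations in terms of morphisms\<close>

lemma op_s_iff:
  assumes X: "X \<subseteq> U"
  shows "A \<in> op_s K U X \<longleftrightarrow>
    A \<in> U \<and> (\<exists>H\<in>X. \<exists>f. alg_morphism K A H f \<and> inj_on f (carrier A))"
proof (cases "A \<in> U")
  case True
  then interpret A: nonassoc_algebra K A by (rule algebras)
  have "(\<exists>B. subalg K B H \<and> alg_iso K A (H\<lparr>carrier := B\<rparr>)) \<longleftrightarrow>
    (\<exists>f. alg_morphism K A H f \<and> inj_on f (carrier A))" (is "?L \<longleftrightarrow> ?R") if "H \<in> X" for H
  proof
    interpret H: nonassoc_algebra K H using that X algebras by blast
    {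
      assume ?L
      then obtain B f where B: "subalg K B H" and f: "f \<in> alg_hom K A (H\<lparr>carrier := B\<rparr>)"
        and bij: "bij_betw f (carrier A) B" by (auto simp: alg_iso_def)
      have "f \<in> alg_hom K A H"
        using alg_homD[OF f] H.subalgD(1)[OF B] by (intro alg_homI) auto
      then have "alg_morphism K A H f" by unfold_locales
      then show ?R using bij by (auto simp: bij_betw_def)
    next
      assume ?R
      then obtain f where f: "alg_morphism K A H f" "inj_on f (carrier A)" by blast
      interpret f: alg_morphism K A H f by fact
      have "subalg K (f ` carrier A) H" by (rule f.subalg_image[OF A.subalg_carrier])
      moreover have "f \<in> alg_hom K A (H\<lparr>carrier := f ` carrier A\<rparr>)"
        by (intro alg_homI) auto
      ultimately show ?L using f(2) by (auto simp: alg_iso_def bij_betw_def)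
    }
  qed
  then show ?thesis using True by (simp add: op_s_def)
qed (simp add: op_s_def)

lemma op_Q_iff:
  assumes X: "X \<subseteq> U"
  shows "A \<in> op_Q K U X \<longleftrightarrow> A \<in> U \<and> (\<exists>H\<in>X. \<exists>f. alg_epi K H A f)"
  using X algebras
  by (auto simp: op_Q_def alg_epi_def alg_epi_axioms_def alg_morphism_def alg_morphism_axioms_def)

text \<open>
  The next two lemmas translate between internal direct sums of ideals and products given by
  projections; for the second, the ideals are the summands of the product, which are isomorphic to
  its factors.
\<close>

lemma op_D0_product_cone:
  assumes X: "X \<subseteq> U" and A: "A \<in> op_D0 K U X"
  obtains J :: "nat set" and H p where
    "product_cone K A J H p" "J \<noteq> {}" "\<And>j. j \<in> J \<Longrightarrow> H j \<in> X"
proof -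
  obtain r I where r: "r \<ge> 1" and I: "is_direct_sum K A r I"
    and IX: "\<And>j. j \<in> {1..r} \<Longrightarrow> A\<lparr>carrier := I j\<rparr> \<in> X"
    using A unfolding op_D0_def by blast
  have "A \<in> U" using A by (simp add: op_D0_def)
  then obtain p where "product_cone K A {1..r} (\<lambda>j. A\<lparr>carrier := I j\<rparr>) p"
    using direct_sum_product_cone[OF algebras I] IX X algebras by (metis subsetD)
  then show thesis by (rule that) (use r IX in auto)
qed

lemma product_cone_op_D0:
  fixes H :: "'i \<Rightarrow> ('k, 'a) module"
  assumes X: "alg_class K U X" and cone: "product_cone K A J H p" and J: "J \<noteq> {}"
    and HX: "\<And>j. j \<in> J \<Longrightarrow> H j \<in> X"
  shows "A \<in> op_D0 K U X"
proof -
  have XU: "X \<subseteq> U" using X by (rule alg_class_subset)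
  interpret c: product_cone K A J H p by fact
  obtain e where e: "bij_betw e {1..card J} J"
    using ex_bij_betw_nat_finite_1[OF c.finite_index] by blast
  let ?J = "{1..card J}"
  interpret d: product_cone K A ?J "H \<circ> e" "p \<circ> e" by (rule c.reindex[OF e])
  have "A \<in> U" using HX XU by (intro product_closed[OF cone]) blast
  moreover have "card J \<ge> 1" using c.finite_index J by (simp add: Suc_le_eq card_gt_0_iff)
  moreover have "is_direct_sum K A (card J) d.summand"
    by (rule is_direct_sum_summands[OF d.product_cone_axioms])
  moreover have "A\<lparr>carrier := d.summand j\<rparr> \<in> X" if j: "j \<in> ?J" for j
  proof -
    have "e j \<in> J" using bij_betwE[OF e] j by blast
    then have "(H \<circ> e) j \<in> X" using HX by simp
    moreover obtain h where "alg_epi K ((H \<circ> e) j) (A\<lparr>carrier := d.summand j\<rparr>) h"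
      "inj_on h (carrier ((H \<circ> e) j))"
      using alg_epi_inverse[OF d.proj_epi(1)[OF j]] d.proj_epi(2)[OF j] by force
    ultimately show ?thesis using alg_class_iso[OF X] by blast
  qed
  ultimately show ?thesis unfolding op_D0_def by blast
qed

lemma singleton_product_cone:
  assumes "nonassoc_algebra K A"
  shows "product_cone K A {0 :: nat} (\<lambda>_. A) (\<lambda>_ x. x)"
  using alg_morphism_id[OF assms] assms
  by (intro product_cone.intro product_cone_axioms.intro) (auto simp: id_def)

lemma op_D0_extensive: "alg_class K U X \<Longrightarrow> X \<subseteq> op_D0 K U X"
  using product_cone_op_D0[OF _ singleton_product_cone] algebras alg_class_subset by blast

lemma op_s_subset: "op_s K U X \<subseteq> U"
  and op_D0_subset: "op_D0 K U X \<subseteq> U"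
  and op_Q_subset: "op_Q K U X \<subseteq> U"
  and op_E_Phi_subset: "op_E_Phi K U X \<subseteq> U"
  by (auto simp: op_s_def op_D0_def op_Q_def op_E_Phi_def)

lemma op_s_mono: "X \<subseteq> Y \<Longrightarrow> op_s K U X \<subseteq> op_s K U Y"
  and op_Q_mono: "X \<subseteq> Y \<Longrightarrow> op_Q K U X \<subseteq> op_Q K U Y"
  and op_E_Phi_mono: "X \<subseteq> Y \<Longrightarrow> op_E_Phi K U X \<subseteq> op_E_Phi K U Y"
  unfolding op_s_def op_Q_def op_E_Phi_def by blast+

lemma op_D0_mono: "X \<subseteq> Y \<Longrightarrow> op_D0 K U X \<subseteq> op_D0 K U Y"
  unfolding op_D0_def by (intro Collect_mono) (meson subsetD)

subsection \<open>Subalgebras of direct sums\<close>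

text \<open>
  The data of an embedding into a finite product, without mention of the product. Such families can
  be composed index by index.
\<close>

definition separating_family :: "('k, 'a) module \<Rightarrow> 'i set \<Rightarrow> ('i \<Rightarrow> ('k, 'a) module) \<Rightarrow>
    ('i \<Rightarrow> 'a \<Rightarrow> 'a) \<Rightarrow> bool" where
  "separating_family A J H g \<longleftrightarrow> finite J \<and> J \<noteq> {} \<and> (\<forall>j\<in>J. alg_morphism K A (H j) (g j)) \<and>
    (\<forall>x\<in>carrier A. (\<forall>j\<in>J. g j x = \<zero>\<^bsub>H j\<^esub>) \<longrightarrow> x = \<zero>\<^bsub>A\<^esub>)"

lemma separating_family_op_sD0:
  assumes X: "alg_class K U X" and A: "A \<in> U"
    and sep: "separating_family A J H g" and HX: "\<And>j. j \<in> J \<Longrightarrow> H j \<in> X"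
  shows "A \<in> op_s K U (op_D0 K U X)"
proof -
  have g: "finite J" "J \<noteq> {}" "\<And>j. j \<in> J \<Longrightarrow> alg_morphism K A (H j) (g j)"
    and zero: "\<And>x. \<lbrakk>x \<in> carrier A; \<And>j. j \<in> J \<Longrightarrow> g j x = \<zero>\<^bsub>H j\<^esub>\<rbrakk> \<Longrightarrow> x = \<zero>\<^bsub>A\<^esub>"
    using sep by (auto simp: separating_family_def)
  have "H j \<in> U" if "j \<in> J" for j using HX[OF that] alg_class_subset[OF X] by blast
  then obtain P :: "('k, 'a) module" and p where P: "product_cone K P J H p"
    using product_exists[OF g(1,2)] by metis
  interpret product_cone K P J H p by fact
  obtain f where f: "alg_morphism K A P f"
    "\<And>j x. \<lbrakk>j \<in> J; x \<in> carrier A\<rbrakk> \<Longrightarrow> p j (f x) = g j x"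
    using mediating_morphism[OF algebras[OF A] g(3)] by blast
  interpret f: alg_morphism K A P f by fact
  have "inj_on f (carrier A)"
    unfolding f.inj_on_iff
  proof (intro ballI impI)
    fix x assume x: "x \<in> carrier A" "f x = \<zero>\<^bsub>P\<^esub>"
    show "x = \<zero>\<^bsub>A\<^esub>"
    proof (rule zero[OF x(1)])
      fix j assume j: "j \<in> J"
      then show "g j x = \<zero>\<^bsub>H j\<^esub>"
        using f(2)[OF j x(1)] x(2) alg_morphism.map_zero[OF proj[OF j]] by simp
    qed
  qed
  moreover have "P \<in> op_D0 K U X" using X P g(2) HX by (rule product_cone_op_D0)
  ultimately show ?thesis using A f(1) op_s_iff[OF op_D0_subset] by blast
qed

lemma op_sD0_separating_family:
  assumes X: "X \<subseteq> U" and A: "A \<in> op_s K U (op_D0 K U X)"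
  obtains J :: "nat set" and H g where
    "separating_family A J H g" "\<And>j. j \<in> J \<Longrightarrow> H j \<in> X"
proof -
  obtain D f where D: "D \<in> op_D0 K U X" and f: "alg_morphism K A D f" "inj_on f (carrier A)"
    using A op_s_iff[OF op_D0_subset] by blast
  obtain J :: "nat set" and H p where
    c: "product_cone K D J H p" "J \<noteq> {}" "\<And>j. j \<in> J \<Longrightarrow> H j \<in> X"
    using op_D0_product_cone[OF X D] by metis
  interpret product_cone K D J H p by fact
  interpret f: alg_morphism K A D f by fact
  have "separating_family A J H (\<lambda>j. p j \<circ> f)"
    unfolding separating_family_def
  proof (intro conjI ballI impI)
    show "alg_morphism K A (H j) (p j \<circ> f)" if "j \<in> J" for j
      using alg_morphism_comp[OF f(1) proj[OF that]] .
    fix x assume x: "x \<in> carrier A" and zero: "\<forall>j\<in>J. (p j \<circ> f) x = \<zero>\<^bsub>H j\<^esub>"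
    have "f x = \<zero>\<^bsub>D\<^esub>"
    proof (rule proj_eqI)
      fix j assume j: "j \<in> J"
      then show "p j (f x) = p j \<zero>\<^bsub>D\<^esub>"
        using zero alg_morphism.map_zero[OF proj[OF j]] by simp
    qed (use x in auto)
    then show "x = \<zero>\<^bsub>A\<^esub>" using f(2)[unfolded f.inj_on_iff] x by simp
  qed (use finite_index c(2) in auto)
  then show thesis using c(3) by (rule that)
qed

theorem closure_operation_sD0: "closure_operation K U (op_s K U \<circ> op_D0 K U)"
proof (rule closure_operationI; simp only: o_apply)
  show "op_s K U (op_D0 K U X) \<subseteq> U" for X by (rule op_s_subset)
  show "op_s K U (op_D0 K U {}) = {}"
    by (auto simp: op_s_def op_D0_def)
  show "op_s K U (op_D0 K U X) \<subseteq> op_s K U (op_D0 K U Y)" if "X \<subseteq> Y" for X Y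
    using that by (intro op_s_mono op_D0_mono)
next
  fix X A B f
  assume "A \<in> op_s K U (op_D0 K U X)" "B \<in> U" "alg_epi K B A f" "inj_on f (carrier B)"
  moreover from this obtain H g where "H \<in> op_D0 K U X" "alg_morphism K A H g" "inj_on g (carrier A)"
    using op_s_iff[OF op_D0_subset] by blast
  moreover have "inj_on (g \<circ> f) (carrier B)"
    using calculation by (intro comp_inj_on) (auto simp: alg_epi_def alg_epi_axioms_def)
  ultimately show "B \<in> op_s K U (op_D0 K U X)"
    using alg_morphism_comp op_s_iff[OF op_D0_subset] by (metis alg_epi.axioms(1))
next
  fix X assume X: "alg_class K U X"
  show "X \<subseteq> op_s K U (op_D0 K U X)"
  proof
    fix A assume "A \<in> X"
    then have "A \<in> op_D0 K U X" "A \<in> U" using op_D0_extensive[OF X] op_D0_subset by blast+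
    then show "A \<in> op_s K U (op_D0 K U X)"
      using op_s_iff[OF op_D0_subset] alg_morphism_id[OF algebras] by (metis inj_on_id)
  qed
  let ?C = "\<lambda>X. op_s K U (op_D0 K U X)"
  show "?C (?C X) \<subseteq> ?C X"
  proof
    fix A assume A: "A \<in> ?C (?C X)"
    then have AU: "A \<in> U" using op_s_subset by blast
    obtain J :: "nat set" and H g where sep: "separating_family A J H g"
      and H: "\<And>j. j \<in> J \<Longrightarrow> H j \<in> ?C X"
      using op_sD0_separating_family[OF op_s_subset A] by metis
    have "\<exists>L :: nat set. \<exists>G h. separating_family (H j) L G h \<and> (\<forall>l\<in>L. G l \<in> X)" if "j \<in> J" for j
      using op_sD0_separating_family[OF alg_class_subset[OF X] H[OF that]] by metis
    then obtain L :: "nat \<Rightarrow> nat set" and G h where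
      sepH: "\<And>j. j \<in> J \<Longrightarrow> separating_family (H j) (L j) (G j) (h j)"
      and G: "\<And>j l. \<lbrakk>j \<in> J; l \<in> L j\<rbrakk> \<Longrightarrow> G j l \<in> X"
      by metis
    have "separating_family A (Sigma J L) (\<lambda>(j, l). G j l) (\<lambda>(j, l). h j l \<circ> g j)"
      unfolding separating_family_def
    proof (intro conjI ballI impI)
      show "finite (Sigma J L)" using sep sepH by (auto simp: separating_family_def)
      obtain j where "j \<in> J" using sep by (auto simp: separating_family_def)
      moreover from this obtain l where "l \<in> L j"
        using sepH[of j] by (auto simp: separating_family_def)
      ultimately show "Sigma J L \<noteq> {}" by blast
      fix x assume x: "x \<in> carrier A"
        and zero: "\<forall>i\<in>Sigma J L. (case i of (j, l) \<Rightarrow> h j l \<circ> g j) x = \<zero>\<^bsub>case i of (j, l) \<Rightarrow> G j l\<^esub>"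
      have "g j x = \<zero>\<^bsub>H j\<^esub>" if j: "j \<in> J" for j
      proof -
        have "g j x \<in> carrier (H j)"
          using sep j by (intro alg_morphism.map_closed[OF _ x, where K = K]) (simp add: separating_family_def)
        moreover have "h j l (g j x) = \<zero>\<^bsub>G j l\<^esub>" if "l \<in> L j" for l
          using zero j that by force
        ultimately show ?thesis using sepH[OF j] by (simp add: separating_family_def)
      qed
      then show "x = \<zero>\<^bsub>A\<^esub>" using sep x by (simp add: separating_family_def)
    next
      fix i assume "i \<in> Sigma J L"
      then obtain j l where "i = (j, l)" "j \<in> J" "l \<in> L j" by blast
      then show "alg_morphism K A (case i of (j, l) \<Rightarrow> G j l) (case i of (j, l) \<Rightarrow> h j l \<circ> g j)"
        using sep sepH by (auto simp: separating_family_def intro: alg_morphism_comp)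
    qed
    then show "A \<in> ?C X"
      by (rule separating_family_op_sD0[OF X AU]) (use G in auto)
  qed
qed

end

section \<open>Frattini extensions\<close>

definition frattini_epi ::
    "('k, 'm) ring_scheme \<Rightarrow> ('k, 'a) module \<Rightarrow> ('k, 'b) module \<Rightarrow> ('a \<Rightarrow> 'b) \<Rightarrow> bool" where
  "frattini_epi K A B f \<longleftrightarrow> alg_epi K A B f \<and> a_kernel A B f \<subseteq> frattini_subalg K A"

lemma frattini_epi_comp:
  "\<lbrakk>frattini_epi K A B f; frattini_epi K B C g\<rbrakk> \<Longrightarrow> frattini_epi K A C (g \<circ> f)"
  unfolding frattini_epi_def using alg_epi_comp frattini_kernel_comp by blast

lemma inj_frattini_epi:
  assumes "alg_epi K A B f" "inj_on f (carrier A)"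
  shows "frattini_epi K A B f"
proof -
  interpret alg_epi K A B f by fact
  have "a_kernel A B f \<subseteq> {\<zero>\<^bsub>A\<^esub>}" using assms(2) inj_on_iff by (auto simp: a_kernel_def')
  moreover have "\<zero>\<^bsub>A\<^esub> \<in> frattini_subalg K A"
    using subgroup.one_closed[OF submodule.axioms(1)[OF A.submodule_frattini]] by simp
  ultimately show ?thesis using assms(1) by (auto simp: frattini_epi_def)
qed

lemma frattini_epi_id: "nonassoc_algebra K A \<Longrightarrow> frattini_epi K A A id"
  by (intro inj_frattini_epi) (auto simp: alg_epi_def alg_epi_axioms_def alg_morphism_id)

text \<open>
  \<open>D\<close> is \<open>B\<close> divided by \<open>g (ker f)\<close>. It is also a quotient of \<open>C\<close>, since \<open>ker f\<close> dies in \<open>D\<close>.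
\<close>

lemma pushout_exists:
  fixes B :: "('k, 'b) module" and C :: "('k, 'c) module"
  assumes g: "alg_epi K A B g" and f: "frattini_epi K A C f"
  obtains D :: "('k, 'b) module" and u v where "frattini_epi K B D u" "alg_epi K C D v"
proof -
  interpret f: alg_epi K A C f using f by (simp add: frattini_epi_def)
  interpret g: alg_epi K A B g by fact
  have "alg_ideal K (g ` a_kernel A C f) B"
    using f.ideal_kernel by (rule g.ideal_image)
  then obtain D :: "('k, 'b) module" and u where u: "alg_epi K B D u"
    and ker: "a_kernel B D u = g ` a_kernel A C f"
    using quotient_exists[OF g.B.nonassoc_algebra_axioms] by metis
  interpret u: alg_epi K B D u by fact
  have "a_kernel B D u \<subseteq> frattini_subalg K B"
    using f g.frattini_image unfolding ker frattini_epi_def by blast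
  then have fu: "frattini_epi K B D u" using u by (simp add: frattini_epi_def)
  have "a_kernel A C f \<subseteq> a_kernel A D (u \<circ> g)"
  proof
    fix x assume x: "x \<in> a_kernel A C f"
    then have "g x \<in> a_kernel B D u" using ker by blast
    then show "x \<in> a_kernel A D (u \<circ> g)" using x by (simp add: a_kernel_def')
  qed
  then obtain v where v: "alg_morphism K C D v"
    "\<And>x. x \<in> carrier A \<Longrightarrow> v (f x) = (u \<circ> g) x"
    using f.factor_through alg_morphism_comp[OF g.alg_morphism_axioms u.alg_morphism_axioms]
    by metis
  have "v ` carrier C = (u \<circ> g) ` carrier A"
    using v(2) unfolding f.surj[symmetric] image_image by (intro image_cong) auto
  also have "\<dots> = carrier D" using g.surj u.surj by (metis image_comp)
  finally have "alg_epi K C D v" using v(1) by (simp add: alg_epi_def alg_epi_axioms_def)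
  with fu show thesis by (rule that)
qed

context algebra_universe
begin

lemma op_E_Phi_iff_frattini_epi:
  "X \<subseteq> U \<Longrightarrow> A \<in> op_E_Phi K U X \<longleftrightarrow> A \<in> U \<and> (\<exists>B\<in>X. \<exists>f. frattini_epi K A B f)"
  using op_E_Phi_iff[OF subset_all_algebras] by (simp add: frattini_epi_def)

lemma op_E_Phi_closed_under_frattini_epi:
  assumes "X \<subseteq> U" "A \<in> U" "frattini_epi K A B f" "B \<in> op_E_Phi K U X"
  shows "A \<in> op_E_Phi K U X"
  using assms op_E_Phi_iff_frattini_epi frattini_epi_comp by metis

lemma op_E_Phi_extensive:
  assumes "X \<subseteq> U"
  shows "X \<subseteq> op_E_Phi K U X"
proof
  fix A assume A: "A \<in> X"
  then have "A \<in> U" using assms by blast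
  then show "A \<in> op_E_Phi K U X"
    using A frattini_epi_id[OF algebras] by (auto simp: op_E_Phi_iff_frattini_epi[OF assms])
qed

lemma op_Q_extensive:
  assumes "X \<subseteq> U"
  shows "X \<subseteq> op_Q K U X"
proof
  fix A assume A: "A \<in> X"
  then have "A \<in> U" using assms by blast
  then show "A \<in> op_Q K U X"
    using A frattini_epi_id[OF algebras] by (auto simp: op_Q_iff[OF assms] frattini_epi_def)
qed

lemma op_Q_epi:
  assumes "X \<subseteq> U" "B \<in> op_Q K U X" "alg_epi K B C g"
  shows "C \<in> op_Q K U X"
proof -
  obtain H f where H: "H \<in> X" "alg_epi K H B f" and B: "B \<in> U"
    using assms(2) by (auto simp: op_Q_iff[OF assms(1)])
  have "alg_epi K H C (g \<circ> f)" using H(2) assms(3) by (rule alg_epi_comp)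
  moreover have "C \<in> U" using B assms(3) by (rule epi_closed)
  ultimately show ?thesis using H(1) by (auto simp: op_Q_iff[OF assms(1)])
qed

text \<open>
  Frattini epimorphisms compose, so the outer two of the four operations in
  \<open>op_E_Phi (C (op_E_Phi (C X)))\<close> can be removed one after the other: \<open>C\<close> by the hypothesis \<open>swap\<close>,
  then \<open>op_E_Phi\<close>.
\<close>

lemma closure_operation_E_Phi_comp:
  assumes sub: "\<And>X. C X \<subseteq> U" and empty: "C {} = {}" and mono: "\<And>X Y. X \<subseteq> Y \<Longrightarrow> C X \<subseteq> C Y"
    and ext: "\<And>X. alg_class K U X \<Longrightarrow> X \<subseteq> C X"
    and swap: "\<And>X A. \<lbrakk>alg_class K U X; A \<in> C (op_E_Phi K U (C X))\<rbrakk> \<Longrightarrow> A \<in> op_E_Phi K U (C X)"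
  shows "closure_operation K U (op_E_Phi K U \<circ> C)"
proof (rule closure_operationI; simp only: o_apply)
  show "op_E_Phi K U (C X) \<subseteq> U" for X by (rule op_E_Phi_subset)
  show "op_E_Phi K U (C {}) = {}" by (simp add: empty op_E_Phi_def)
  show "op_E_Phi K U (C X) \<subseteq> op_E_Phi K U (C Y)" if "X \<subseteq> Y" for X Y
    using that by (intro op_E_Phi_mono mono)
  show "B \<in> op_E_Phi K U (C X)"
    if "A \<in> op_E_Phi K U (C X)" "B \<in> U" "alg_epi K B A f" "inj_on f (carrier B)" for X A B f
    using op_E_Phi_closed_under_frattini_epi[OF sub that(2) inj_frattini_epi[OF that(3,4)] that(1)] .
next
  fix X assume X: "alg_class K U X"
  show "X \<subseteq> op_E_Phi K U (C X)"
    using ext[OF X] op_E_Phi_extensive[OF sub] by blast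
  show "op_E_Phi K U (C (op_E_Phi K U (C X))) \<subseteq> op_E_Phi K U (C X)"
  proof
    fix A assume "A \<in> op_E_Phi K U (C (op_E_Phi K U (C X)))"
    then obtain B f where "A \<in> U" "B \<in> C (op_E_Phi K U (C X))" "frattini_epi K A B f"
      using op_E_Phi_iff_frattini_epi[OF sub] by blast
    then show "A \<in> op_E_Phi K U (C X)"
      using op_E_Phi_closed_under_frattini_epi[OF sub] swap[OF X] by blast
  qed
qed

theorem closure_operation_E_Phi_Q: "closure_operation K U (op_E_Phi K U \<circ> op_Q K U)"
proof (rule closure_operation_E_Phi_comp)
  show "op_Q K U {} = {}" by (simp add: op_Q_def)
  show "X \<subseteq> op_Q K U X" if "alg_class K U X" for X
    using that by (intro op_Q_extensive alg_class_subset)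
  fix X A assume X: "alg_class K U X" and A: "A \<in> op_Q K U (op_E_Phi K U (op_Q K U X))"
  obtain B g where B: "B \<in> op_E_Phi K U (op_Q K U X)" and g: "alg_epi K B A g" and AU: "A \<in> U"
    using A op_Q_iff[OF op_E_Phi_subset] by blast
  obtain C f where C: "C \<in> op_Q K U X" and f: "frattini_epi K B C f"
    using B op_E_Phi_iff_frattini_epi[OF op_Q_subset] by blast
  obtain D :: "('k, 'a) module" and u v where D: "frattini_epi K A D u" "alg_epi K C D v"
    using pushout_exists[OF g f] by metis
  have "D \<in> op_Q K U X" using op_Q_epi[OF alg_class_subset[OF X] C D(2)] .
  then show "A \<in> op_E_Phi K U (op_Q K U X)"
    using AU D(1) op_E_Phi_iff_frattini_epi[OF op_Q_subset] by blast
qed (use op_Q_subset op_Q_mono in auto)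

text \<open>
  In the proof, \<open>P\<close> is the product of all the factors \<open>G j l\<close> of the algebras \<open>D j\<close>, so it plays the role of
  the product of the \<open>D j\<close>. An element in the kernel of \<open>A \<rightarrow> P\<close> has each of its components in the kernel
  of the corresponding Frattini epimorphism \<open>H j \<rightarrow> D j\<close>.
\<close>

lemma op_D0_E_Phi:
  assumes coat: "\<And>A. A \<in> U \<Longrightarrow> coatomic_subalgebras K A"
    and X: "alg_class K U X" and A: "A \<in> op_D0 K U (op_E_Phi K U (op_D0 K U X))"
  shows "A \<in> op_E_Phi K U (op_D0 K U X)"
proof -
  have XU: "X \<subseteq> U" using X by (rule alg_class_subset)
  obtain J :: "nat set" and H p where c: "product_cone K A J H p" and J: "J \<noteq> {}"
    and H: "\<And>j. j \<in> J \<Longrightarrow> H j \<in> op_E_Phi K U (op_D0 K U X)"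
    using op_D0_product_cone[OF op_E_Phi_subset A] by metis
  interpret c: product_cone K A J H p by fact
  have HU: "H j \<in> U" if "j \<in> J" for j using H[OF that] op_E_Phi_subset by blast
  have "\<exists>D q. D \<in> op_D0 K U X \<and> frattini_epi K (H j) D q" if "j \<in> J" for j
    using H[OF that] op_E_Phi_iff_frattini_epi[OF op_D0_subset] by blast
  then obtain D q where D: "\<And>j. j \<in> J \<Longrightarrow> D j \<in> op_D0 K U X"
    and q: "\<And>j. j \<in> J \<Longrightarrow> frattini_epi K (H j) (D j) (q j)" by metis
  have "\<exists>L :: nat set. \<exists>G r. product_cone K (D j) L G r \<and> L \<noteq> {} \<and> (\<forall>l\<in>L. G l \<in> X)" if "j \<in> J" for j
    using op_D0_product_cone[OF XU D[OF that]] by metis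
  then obtain L :: "nat \<Rightarrow> nat set" and G r where
    d: "\<And>j. j \<in> J \<Longrightarrow> product_cone K (D j) (L j) (G j) (r j)"
    and L: "\<And>j. j \<in> J \<Longrightarrow> L j \<noteq> {}"
    and GX: "\<And>j l. \<lbrakk>j \<in> J; l \<in> L j\<rbrakk> \<Longrightarrow> G j l \<in> X" by metis
  have epi_q: "alg_epi K (H j) (D j) (q j)" if "j \<in> J" for j
    using q[OF that] by (simp add: frattini_epi_def)
  let ?I = "Sigma J L" and ?G = "\<lambda>(j, l). G j l"
  have I: "finite ?I" "?I \<noteq> {}"
    using c.finite_index product_cone.finite_index[OF d] J L by auto
  have GX': "?G i \<in> X" if "i \<in> ?I" for i using that GX by auto
  obtain P :: "('k, 'a) module" and s where P: "product_cone K P ?I ?G s"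
    using product_exists[OF I] GX' XU by (metis subsetD)
  interpret P: product_cone K P ?I ?G s by fact
  have mor: "alg_morphism K A (?G i) ((\<lambda>(j, l). r j l \<circ> (q j \<circ> p j)) i)" if "i \<in> ?I" for i
    using that c.proj product_cone.proj[OF d] alg_epi.axioms(1)[OF epi_q]
    by (auto intro!: alg_morphism_comp)
  obtain m where m: "alg_morphism K A P m"
    and sm: "\<And>i x. \<lbrakk>i \<in> ?I; x \<in> carrier A\<rbrakk> \<Longrightarrow> s i (m x) = (\<lambda>(j, l). r j l \<circ> (q j \<circ> p j)) i x"
    by (rule P.mediating_morphism[OF c.A.nonassoc_algebra_axioms mor]) (assumption, rule that, assumption, blast)
  interpret m: alg_morphism K A P m by fact
  have smjl: "s (j, l) (m x) = r j l (q j (p j x))" if "j \<in> J" "l \<in> L j" "x \<in> carrier A" for j l x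
    using sm[of "(j, l)" x] that by simp
  have "m ` carrier A = carrier P"
  proof
    show "carrier P \<subseteq> m ` carrier A"
    proof
      fix u assume u: "u \<in> carrier P"
      have "\<exists>h. h \<in> carrier (H j) \<and> (\<forall>l\<in>L j. r j l (q j h) = s (j, l) u)" if j: "j \<in> J" for j
      proof -
        have "\<exists>d. d \<in> carrier (D j) \<and> (\<forall>l\<in>L j. r j l d = s (j, l) u)"
        proof (rule product_cone.proj_exists[OF d[OF j]])
          fix l assume "l \<in> L j"
          then have "alg_morphism K P (G j l) (s (j, l))" using P.proj[of "(j, l)"] j by simp
          then show "s (j, l) u \<in> carrier (G j l)" using u by (rule alg_morphism.map_closed)
        qed
        then show ?thesis using alg_epi.preimage_exists[OF epi_q[OF j]] by metis
      qed
      then obtain h where h: "\<And>j. j \<in> J \<Longrightarrow> h j \<in> carrier (H j)"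
        and rq: "\<And>j l. \<lbrakk>j \<in> J; l \<in> L j\<rbrakk> \<Longrightarrow> r j l (q j (h j)) = s (j, l) u" by metis
      obtain x where x: "x \<in> carrier A" "\<forall>j\<in>J. p j x = h j" using c.proj_exists[OF h] by blast
      have "m x = u"
      proof (rule P.proj_eqI)
        fix i assume "i \<in> ?I"
        then show "s i (m x) = s i u" using smjl x rq by auto
      qed (use x u in auto)
      then show "u \<in> m ` carrier A" using x(1) by blast
    qed
  qed auto
  then have epi: "alg_epi K A P m" using m by (simp add: alg_epi_def alg_epi_axioms_def)
  have "a_kernel A P m \<subseteq> frattini_subalg K A"
  proof
    fix x assume "x \<in> a_kernel A P m"
    then have x: "x \<in> carrier A" "m x = \<zero>\<^bsub>P\<^esub>" by (auto simp: a_kernel_def')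
    show "x \<in> frattini_subalg K A"
    proof (rule c.frattini_by_components[OF x(1)])
      fix j assume j: "j \<in> J"
      interpret qj: alg_epi K "H j" "D j" "q j" using j by (rule epi_q)
      interpret dj: product_cone K "D j" "L j" "G j" "r j" using j by (rule d)
      show "coatomic_subalgebras K (H j)" using HU[OF j] by (rule coat)
      show "alg_ideal K (a_kernel (H j) (D j) (q j)) (H j)" by (rule qj.ideal_kernel)
      show "a_kernel (H j) (D j) (q j) \<subseteq> frattini_subalg K (H j)"
        using q[OF j] by (simp add: frattini_epi_def)
      have pC: "p j x \<in> carrier (H j)" using alg_morphism.map_closed[OF c.proj[OF j] x(1)] .
      have "q j (p j x) = \<zero>\<^bsub>D j\<^esub>"
      proof (rule dj.proj_eqI)
        fix l assume l: "l \<in> L j"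
        have "s (j, l) \<zero>\<^bsub>P\<^esub> = \<zero>\<^bsub>G j l\<^esub>"
          using alg_morphism.map_zero[OF P.proj[of "(j, l)"]] j l by simp
        then show "r j l (q j (p j x)) = r j l \<zero>\<^bsub>D j\<^esub>"
          using smjl[OF j l x(1)] x(2) alg_morphism.map_zero[OF dj.proj[OF l]] by simp
      qed (use pC in auto)
      then show "p j x \<in> a_kernel (H j) (D j) (q j)" using pC by (simp add: a_kernel_def')
    qed
  qed
  then have "frattini_epi K A P m" using epi by (simp add: frattini_epi_def)
  moreover have "P \<in> op_D0 K U X" using product_cone_op_D0[OF X P I(2) GX'] .
  moreover have "A \<in> U" using A op_D0_subset by blast
  ultimately show ?thesis using op_E_Phi_iff_frattini_epi[OF op_D0_subset] by blast
qed

theorem closure_operation_E_Phi_D0: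
  assumes "\<And>A. A \<in> U \<Longrightarrow> coatomic_subalgebras K A"
  shows "closure_operation K U (op_E_Phi K U \<circ> op_D0 K U)"
proof (rule closure_operation_E_Phi_comp)
  show "op_D0 K U {} = {}" by (auto simp: op_D0_def)
  show "X \<subseteq> op_D0 K U X" if "alg_class K U X" for X using that by (rule op_D0_extensive)
qed (use op_D0_subset op_D0_mono op_D0_E_Phi[OF assms] in auto)

end

section \<open>All algebras and finite-dimensional algebras\<close>

lemma algebra_universe_all:
  assumes "infinite (UNIV :: 'a set)"
  shows "algebra_universe K (all_algebras K :: ('k, 'a) module set)"
  using assms
  by (intro algebra_universe.intro)
    (auto simp: all_algebras_def alg_epi_def alg_morphism_def product_cone_def)

lemma algebra_universe_fd:
  assumes "infinite (UNIV :: 'a set)"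
  shows "algebra_universe K (fd_algebras K :: ('k, 'a) module set)"
proof (rule algebra_universe.intro)
  show "infinite (UNIV :: 'a set)" by fact
  show "nonassoc_algebra K A" if "A \<in> fd_algebras K" for A :: "('k, 'a) module"
    using that by (simp add: fd_algebras_def)
  show "B \<in> fd_algebras K" if "A \<in> fd_algebras K" and e: "alg_epi K A B f"
    for A B :: "('k, 'a) module" and f
    using that(1) alg_epi.finite_dimensional_image[OF e] e
    by (simp add: fd_algebras_def alg_epi_def alg_morphism_def)
  show "A \<in> fd_algebras K" if c: "product_cone K A J H p"
    and "\<And>j. j \<in> J \<Longrightarrow> H j \<in> fd_algebras K"
    for A :: "('k, 'a) module" and J :: "nat set" and H :: "nat \<Rightarrow> ('k, 'a) module" and p
    using that(2) product_cone.finite_dimensional_product[OF c] c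
    by (simp add: fd_algebras_def product_cone_def)
qed

theorem lemma3p8:
  fixes K :: "('k, 'm) ring_scheme"
    and Alg FDAlg :: "('k, 'a) module set"
  assumes "field K"
    and "infinite (UNIV :: 'a set)"
    and "Alg = all_algebras K"
    and "FDAlg = fd_algebras K"
  shows
    "(closure_operation K Alg (op_s K Alg \<circ> op_D0 K Alg) \<and>
      closure_operation K Alg (op_E_Phi K Alg \<circ> op_Q K Alg)) \<and>
     (closure_operation K FDAlg (op_s K FDAlg \<circ> op_D0 K FDAlg) \<and>
      closure_operation K FDAlg (op_E_Phi K FDAlg \<circ> op_D0 K FDAlg) \<and>
      closure_operation K FDAlg (op_E_Phi K FDAlg \<circ> op_Q K FDAlg))"
proof -
  interpret all: algebra_universe K Alg
    using algebra_universe_all[OF assms(2), of K] by (simp only: assms(3))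
  interpret fd: algebra_universe K FDAlg
    using algebra_universe_fd[OF assms(2), of K] by (simp only: assms(4))
  have "coatomic_subalgebras K A" if "A \<in> FDAlg" for A
    using that nonassoc_algebra.finite_dimensional_coatomic[of K A]
    by (simp add: assms(4) fd_algebras_def)
  then show ?thesis
    using all.closure_operation_sD0 all.closure_operation_E_Phi_Q fd.closure_operation_sD0
      fd.closure_operation_E_Phi_D0 fd.closure_operation_E_Phi_Q by blast
qed

end
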